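(* Let $N\ge1$, let $U$ be an $N\times N$ unitary matrix, and let $\rho$ be an $N\times N$ density matrix with eigenvalues $\lambda_1\ge\dots\ge\lambda_N$ (set $\lambda_j=0$ for $N<j\le 2N$). Let $p_i=\langle i|\rho|i\rangle$ and $q_i=\langle i|U^\dagger\rho U|i\rangle$ for $i=1,\dots,N$, and let $W^{(\lambda)}\in\mathbb{R}^{2N}$ be the vector defined below. Then: (a) $H(p)+H(q)\ge-\sum_{i=1}^{2N}W^{(\lambda)}_i\ln W^{(\lambda)}_i$; (b) for every $\alpha$ with $0\le\alpha<1$, $H_\alpha(p)+H_\alpha(q)\ge\frac{1}{1-\alpha}\ln\Big(\sum_{i=1}^{2N}\big(W^{(\lambda)}_i\big)^{\alpha}-1\Big)$; (c) for every $\alpha\ge0$, $T_\alpha(p)+T_\alpha(q)\ge\frac{1}{1-\alpha}\Big(\sum_{i=1}^{2N}\big(W^{(\lambda)}_i\big)^{\alpha}-2\Big)$ (for $\alpha=1$ interpreted as the limit $\alpha\to1$, i.e. statement (a)).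
   Context: For $k=1,\dots,2N-1$ let $s_k=\max\{\|M\| : M \text{ a submatrix of } U,\ \#\mathrm{rows}(M)+\#\mathrm{cols}(M)=k+1\}$ with $\|\cdot\|$ the operator norm. For $k=1,\dots,2N$: if $k=2n$, $S_k=\sum_{j=1}^{n}\lambda_j(1+s_{k-j})+\sum_{j=n+1}^{k}\lambda_j(1-s_{j-1})$; if $k=2n+1$ ($n\ge0$), $S_k=\sum_{j=1}^{n}\lambda_j(1+s_{k-j})+\lambda_{n+1}+\sum_{j=n+2}^{k}\lambda_j(1-s_{j-1})$. Set $S_0=0$ and $W^{(\lambda)}_k=S_k-S_{k-1}$. Entropies of a probability vector $p$: Shannon $H(p)=-\sum_i p_i\ln p_i$; Rényi $H_\alpha(p)=\frac{1}{1-\alpha}\ln\sum_i p_i^\alpha$; Tsallis $T_\alpha(p)=\frac{1}{1-\alpha}(\sum_i p_i^\alpha-1)$; conventions $0\ln0=0$ and, for $\alpha=0$, $0^0=0$ (sums run over nonzero entries). *)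

theory Defs
  imports Complex_Main "Jordan_Normal_Form.DL_Submatrix" "Jordan_Normal_Form.Schur_Decomposition"
    "Jordan_Normal_Form.Char_Poly"
begin

(* Matrices are Jordan_Normal_Form matrices, indices 0-based:
   paper index i (1..N) corresponds to JNF index i-1. *)

definition unitary_mat :: "nat \<Rightarrow> complex mat \<Rightarrow> bool" where
  "unitary_mat N U \<longleftrightarrow> U \<in> carrier_mat N N \<and> mat_adjoint U * U = 1\<^sub>m N \<and> U * mat_adjoint U = 1\<^sub>m N"

definition density_mat :: "nat \<Rightarrow> complex mat \<Rightarrow> bool" where
  "density_mat N \<rho> \<longleftrightarrow> \<rho> \<in> carrier_mat N N \<and> mat_adjoint \<rho> = \<rho>
     \<and> (\<forall>v \<in> carrier_vec N. 0 \<le> Re (cscalar_prod (\<rho> *\<^sub>v v) v)) \<and> (\<Sum>i<N. \<rho> $$ (i, i)) = 1"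

definition vnorm2 :: "complex vec \<Rightarrow> real" where
  "vnorm2 v = sqrt (\<Sum>i<dim_vec v. (cmod (v $ i))\<^sup>2)"

definition op_norm :: "complex mat \<Rightarrow> real" where
  "op_norm M = Sup {vnorm2 (M *\<^sub>v x) | x. x \<in> carrier_vec (dim_col M) \<and> vnorm2 x \<le> 1}"

definition s_val :: "nat \<Rightarrow> complex mat \<Rightarrow> nat \<Rightarrow> real" where
  "s_val N U k = Max {op_norm (submatrix U R C) | R C.
      R \<subseteq> {..<N} \<and> C \<subseteq> {..<N} \<and> R \<noteq> {} \<and> C \<noteq> {} \<and> card R + card C = k + 1}"

definition lam_ext :: "nat \<Rightarrow> (nat \<Rightarrow> real) \<Rightarrow> nat \<Rightarrow> real" where
  "lam_ext N lam j = (if j \<le> N then lam j else 0)"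

definition S_val :: "nat \<Rightarrow> complex mat \<Rightarrow> (nat \<Rightarrow> real) \<Rightarrow> nat \<Rightarrow> real" where
  "S_val N U lam k =
    (if k = 0 then 0
     else if even k then
       (let n = k div 2 in
         (\<Sum>j=1..n. lam_ext N lam j * (1 + s_val N U (k - j)))
         + (\<Sum>j=n+1..k. lam_ext N lam j * (1 - s_val N U (j - 1))))
     else
       (let n = k div 2 in
         (\<Sum>j=1..n. lam_ext N lam j * (1 + s_val N U (k - j)))
         + lam_ext N lam (n + 1)
         + (\<Sum>j=n+2..k. lam_ext N lam j * (1 - s_val N U (j - 1)))))"

definition W_val :: "nat \<Rightarrow> complex mat \<Rightarrow> (nat \<Rightarrow> real) \<Rightarrow> nat \<Rightarrow> real" where
  "W_val N U lam k = S_val N U lam k - S_val N U lam (k - 1)"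

(* entropies of a vector p indexed by a finite set I; conventions 0 ln 0 = 0,
   and 0 powr a = 0 (in particular 0^0 = 0 for alpha = 0) *)
definition shannon :: "nat set \<Rightarrow> (nat \<Rightarrow> real) \<Rightarrow> real" where
  "shannon I p = - (\<Sum>i\<in>I. if p i = 0 then 0 else p i * ln (p i))"

definition renyi :: "real \<Rightarrow> nat set \<Rightarrow> (nat \<Rightarrow> real) \<Rightarrow> real" where
  "renyi \<alpha> I p = 1 / (1 - \<alpha>) * ln (\<Sum>i\<in>I. p i powr \<alpha>)"

definition tsallis :: "real \<Rightarrow> nat set \<Rightarrow> (nat \<Rightarrow> real) \<Rightarrow> real" where
  "tsallis \<alpha> I p = 1 / (1 - \<alpha>) * ((\<Sum>i\<in>I. p i powr \<alpha>) - 1)"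

end

theory Submission
  imports Defs
begin

text \<open>
  The concatenation of \<open>p\<close> and \<open>q\<close> is majorized by \<open>W\<close>; convexity of the entropy functions and,
  for (b), \<open>(x - 1) (y - 1) \<ge> 0\<close> for \<open>x, y \<ge> 1\<close> then give the three inequalities.

  For the majorization, a sum of entries of \<open>p\<close> over \<open>A\<close> and of \<open>q\<close> over \<open>B\<close>, with
  \<open>k = |A| + |B|\<close>, is the expectation of a sum of two projections \<open>V V*\<close>, where \<open>V\<close> has as
  columns the corresponding \<open>k\<close> basis vectors. By Abel summation over the ordered eigenvalues and
  Ky Fan's principle it suffices to bound the trace of the Gram matrix \<open>G = V* V\<close> against
  projections of rank \<open>m\<close>. Its off-diagonal block is the submatrix \<open>U[A, B]\<close>, so each quadratic
  form of \<open>G\<close> is at most \<open>1 + s (k - 1)\<close>. Removing one index from \<open>A\<close> or \<open>B\<close> lowers both \<open>k\<close> and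
  the rank by one, which yields the bound \<open>m + s (k - 1) + ... + s (k - m)\<close>, and the symmetry of the
  spectrum of \<open>G\<close> about 1 handles \<open>m > k / 2\<close>.
\<close>

section \<open>Orthogonal projections on a finite index set\<close>

text \<open>No eigenvalue of \<open>G\<close> is ever computed: sums of its largest eigenvalues are
  replaced by traces \<open>tr (G T)\<close> over projections \<open>T\<close> of a given rank. Two
  features make the induction on the rank close. Deleting an index from the disjoint union
  \<open>A <+> B\<close> leaves a Gram matrix of the same kind, with one row or one column of the
  block removed; and for k vectors the block satisfies \<open>card A + card B = (k - 1) + 1\<close>,
  which is the size class that defines \<open>s (k - 1)\<close>. Matrices are functions on an
  arbitrary finite index set, so that a deletion needs no renumbering. The obstacle is that past the
  middle the coefficients in \<open>S_val\<close> are not upper bounds for single eigenvalues; only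
  their partial sums dominate. All comparisons therefore go through partial sums, and Abel summation
  occurs twice: against the ordered \<open>lam\<close>, and against the slopes of tangents.\<close>

definition orth_proj :: "'a set \<Rightarrow> ('a \<Rightarrow> 'a \<Rightarrow> complex) \<Rightarrow> bool" where
  "orth_proj J T \<longleftrightarrow> (\<forall>c\<in>J. \<forall>d\<in>J. T c d = cnj (T d c)) \<and>
     (\<forall>c\<in>J. \<forall>d\<in>J. (\<Sum>e\<in>J. T c e * T e d) = T c d)"

lemma orth_proj_idem:
  "orth_proj J T \<Longrightarrow> c \<in> J \<Longrightarrow> d \<in> J \<Longrightarrow> (\<Sum>e\<in>J. T c e * T e d) = T c d"
  unfolding orth_proj_def by blast

lemma orth_proj_herm: "orth_proj J T \<Longrightarrow> c \<in> J \<Longrightarrow> d \<in> J \<Longrightarrow> cnj (T d c) = T c d"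
  unfolding orth_proj_def by metis

lemma orth_projI:
  assumes "\<And>c d. c \<in> J \<Longrightarrow> d \<in> J \<Longrightarrow> cnj (T d c) = T c d"
    and "\<And>c d. c \<in> J \<Longrightarrow> d \<in> J \<Longrightarrow> (\<Sum>e\<in>J. T c e * T e d) = T c d"
  shows "orth_proj J T"
  unfolding orth_proj_def using assms by metis

definition trace_on :: "'a set \<Rightarrow> ('a \<Rightarrow> 'a \<Rightarrow> complex) \<Rightarrow> complex" where
  "trace_on J T = (\<Sum>c\<in>J. T c c)"

lemma sum_of_bool_mult:
  fixes f :: "'a \<Rightarrow> 'b::semiring_1"
  assumes "finite J" "c \<in> J"
  shows "(\<Sum>e\<in>J. of_bool (c = e) * f e) = f c" "(\<Sum>e\<in>J. of_bool (e = c) * f e) = f c"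
    "(\<Sum>e\<in>J. f e * of_bool (c = e)) = f c" "(\<Sum>e\<in>J. f e * of_bool (e = c)) = f c"
  using assms by (simp_all add: of_bool_def if_distrib[of "\<lambda>x. x * _"] if_distrib[of "\<lambda>x. _ * x"] cong: if_cong)

lemma orth_proj_compl:
  fixes T :: "'a \<Rightarrow> 'a \<Rightarrow> complex"
  assumes J: "finite J" and T: "orth_proj J T"
  shows "orth_proj J (\<lambda>c d. of_bool (c = d) - T c d)"
proof -
  have "(\<Sum>e\<in>J. (of_bool (c = e) - T c e) * (of_bool (e = d) - T e d)) = of_bool (c = d) - T c d"
    if "c \<in> J" "d \<in> J" for c d
  proof -
    have "(\<Sum>e\<in>J. (of_bool (c = e) - T c e) * (of_bool (e = d) - T e d)) =
        (\<Sum>e\<in>J. of_bool (c = e) * of_bool (e = d)) - (\<Sum>e\<in>J. of_bool (c = e) * T e d)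
        - (\<Sum>e\<in>J. T c e * of_bool (e = d)) + (\<Sum>e\<in>J. T c e * T e d)"
      by (simp add: algebra_simps sum.distrib sum_subtractf)
    then show ?thesis
      using that J by (simp add: sum_of_bool_mult orth_proj_idem[OF T])
  qed
  then show ?thesis
    by (intro orth_projI) (simp_all add: orth_proj_herm[OF T] eq_commute[of _ "_ :: 'a"] of_bool_def)
qed

lemma orth_proj_diff:
  assumes T: "orth_proj J T"
    and Tu: "\<And>c. c \<in> J \<Longrightarrow> (\<Sum>d\<in>J. T c d * u d) = u c"
    and u: "(\<Sum>c\<in>J. u c * cnj (u c)) = 1"
  shows "orth_proj J (\<lambda>c d. T c d - u c * cnj (u d))"
proof -
  have uT: "(\<Sum>e\<in>J. cnj (u e) * T e d) = cnj (u d)" if "d \<in> J" for d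
  proof -
    have "(\<Sum>e\<in>J. cnj (u e) * T e d) = (\<Sum>e\<in>J. cnj (T d e * u e))"
      by (rule sum.cong) (simp_all add: orth_proj_herm[OF T _ that] mult.commute)
    also have "\<dots> = cnj (\<Sum>e\<in>J. T d e * u e)"
      by (rule cnj_sum[symmetric])
    finally show ?thesis by (simp only: Tu[OF that])
  qed
  have "(\<Sum>e\<in>J. (T c e - u c * cnj (u e)) * (T e d - u e * cnj (u d))) = T c d - u c * cnj (u d)"
    if "c \<in> J" "d \<in> J" for c d
  proof -
    have "(\<Sum>e\<in>J. (T c e - u c * cnj (u e)) * (T e d - u e * cnj (u d))) =
        (\<Sum>e\<in>J. T c e * T e d) - (\<Sum>e\<in>J. T c e * u e) * cnj (u d)
        - u c * (\<Sum>e\<in>J. cnj (u e) * T e d) + u c * (\<Sum>e\<in>J. u e * cnj (u e)) * cnj (u d)"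
      by (simp add: algebra_simps sum.distrib sum_subtractf sum_distrib_left sum_distrib_right)
    then show ?thesis
      using Tu[OF that(1)] uT[OF that(2)] u that by (simp add: orth_proj_idem[OF T])
  qed
  then show ?thesis
    by (intro orth_projI) (simp_all add: orth_proj_herm[OF T])
qed

text \<open>Reduces to removing a direction: \<open>T + u u*\<close> is the complement of
  \<open>(1 - T) - u u*\<close>, and \<open>u\<close> lies in the range of \<open>1 - T\<close>
  because \<open>T\<close> annihilates it.\<close>

lemma orth_proj_add:
  assumes J: "finite J" and T: "orth_proj J T"
    and Tu: "\<And>c. c \<in> J \<Longrightarrow> (\<Sum>d\<in>J. T c d * u d) = 0"
    and u: "(\<Sum>c\<in>J. u c * cnj (u c)) = 1"
  shows "orth_proj J (\<lambda>c d. T c d + u c * cnj (u d))"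
proof -
  have "orth_proj J (\<lambda>c d. (of_bool (c = d) - T c d) - u c * cnj (u d))"
    using Tu J by (intro orth_proj_diff orth_proj_compl assms)
      (simp add: algebra_simps sum_subtractf sum_of_bool_mult)
  from orth_proj_compl[OF J this] show ?thesis by simp
qed

lemma sum_mult_cnj: "(\<Sum>c\<in>J. u c * cnj (u c)) = of_real (\<Sum>c\<in>J. (cmod (u c))\<^sup>2)"
  by (simp add: complex_norm_square flip: of_real_power)

text \<open>The new direction is the normalised component of \<open>y\<close> orthogonal to the range of \<open>T\<close>.\<close>

lemma orth_proj_extend:
  assumes J: "finite J" and T: "orth_proj J T"
    and y: "c0 \<in> J" "(\<Sum>d\<in>J. T c0 d * y d) \<noteq> y c0"
  obtains T' where "orth_proj J T'" "trace_on J T' = trace_on J T + 1"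
    "\<And>c. c \<in> J \<Longrightarrow> (\<Sum>d\<in>J. T' c d * y d) = y c"
    "\<And>z c. (\<And>c. c \<in> J \<Longrightarrow> (\<Sum>d\<in>J. T c d * z d) = z c) \<Longrightarrow> c \<in> J \<Longrightarrow>
       (\<Sum>d\<in>J. T' c d * z d) = z c"
proof -
  define w where "w c = y c - (\<Sum>d\<in>J. T c d * y d)" for c
  define n where "n = sqrt (\<Sum>c\<in>J. (cmod (w c))\<^sup>2)"
  define u where "u c = w c / of_real n" for c
  define T' where "T' = (\<lambda>c d. T c d + u c * cnj (u d))"
  have "(\<Sum>c\<in>J. (cmod (w c))\<^sup>2) > 0"
    using y J by (intro sum_pos2[of _ c0]) (auto simp: w_def)
  then have n: "n > 0" and n2: "n\<^sup>2 = (\<Sum>c\<in>J. (cmod (w c))\<^sup>2)"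
    by (auto simp: n_def)
  have Tw: "(\<Sum>d\<in>J. T c d * w d) = 0" if c: "c \<in> J" for c
  proof -
    have "(\<Sum>d\<in>J. T c d * (\<Sum>e\<in>J. T d e * y e)) = (\<Sum>e\<in>J. (\<Sum>d\<in>J. T c d * T d e) * y e)"
      unfolding sum_distrib_left sum_distrib_right
      by (subst sum.swap) (simp add: mult_ac)
    also have "\<dots> = (\<Sum>e\<in>J. T c e * y e)"
      using c by (intro sum.cong) (simp_all add: orth_proj_idem[OF T])
    finally show ?thesis
      by (simp add: w_def algebra_simps sum_subtractf)
  qed
  \<comment> \<open>Orthogonality of \<open>w\<close> to everything fixed by \<open>T\<close> has
    two uses: \<open>T'\<close> still fixes those vectors, and the inner product of \<open>w\<close>
    with \<open>y\<close> is \<open>n\<^sup>2\<close>.\<close>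
  have orth: "(\<Sum>d\<in>J. cnj (w d) * z d) = 0"
    if z: "\<And>c. c \<in> J \<Longrightarrow> (\<Sum>d\<in>J. T c d * z d) = z c" for z
  proof -
    have "(\<Sum>d\<in>J. cnj (w d) * z d) = (\<Sum>d\<in>J. cnj (w d) * (\<Sum>e\<in>J. T d e * z e))"
      using z by simp
    also have "\<dots> = (\<Sum>e\<in>J. (\<Sum>d\<in>J. T d e * cnj (w d)) * z e)"
      unfolding sum_distrib_left sum_distrib_right
      by (subst sum.swap) (simp add: mult_ac)
    also have "\<dots> = (\<Sum>e\<in>J. cnj (\<Sum>d\<in>J. T e d * w d) * z e)"
    proof (intro sum.cong refl arg_cong2[of _ _ _ _ "(*)"])
      fix e assume "e \<in> J"
      then show "(\<Sum>d\<in>J. T d e * cnj (w d)) = cnj (\<Sum>d\<in>J. T e d * w d)"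
        unfolding cnj_sum complex_cnj_mult by (intro sum.cong refl) (simp only: orth_proj_herm[OF T])
    qed
    also have "\<dots> = 0" using Tw by simp
    finally show ?thesis .
  qed
  have T'z: "(\<Sum>d\<in>J. T' c d * z d) = (\<Sum>d\<in>J. T c d * z d) + w c * (\<Sum>d\<in>J. cnj (w d) * z d) / n\<^sup>2"
    for z c
    by (simp add: T'_def u_def algebra_simps sum.distrib sum_distrib_left sum_divide_distrib power2_eq_square)
  have uu: "(\<Sum>c\<in>J. u c * cnj (u c)) = 1"
  proof -
    have "(\<Sum>c\<in>J. u c * cnj (u c)) = (\<Sum>c\<in>J. w c * cnj (w c)) / of_real (n\<^sup>2)"
      by (simp add: u_def sum_divide_distrib power2_eq_square)
    then show ?thesis using n by (simp add: sum_mult_cnj flip: n2)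
  qed
  have 1: "orth_proj J T'"
    unfolding T'_def using Tw
    by (intro orth_proj_add J T uu) (simp add: u_def flip: sum_divide_distrib)
  have 2: "trace_on J T' = trace_on J T + 1"
    using uu by (simp add: trace_on_def T'_def sum.distrib)
  have 3: "(\<Sum>d\<in>J. T' c d * y d) = y c" if c: "c \<in> J" for c
  proof -
    have TTy: "(\<Sum>d\<in>J. T c d * (\<Sum>e\<in>J. T d e * y e)) = (\<Sum>e\<in>J. T c e * y e)" if "c \<in> J" for c
      using Tw[OF that] by (simp add: w_def algebra_simps sum_subtractf)
    have "(\<Sum>d\<in>J. cnj (w d) * y d) = (\<Sum>d\<in>J. cnj (w d) * w d) + (\<Sum>d\<in>J. cnj (w d) * (\<Sum>e\<in>J. T d e * y e))"
      by (simp add: w_def[of "_"] algebra_simps flip: sum.distrib)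
    also have "\<dots> = (\<Sum>d\<in>J. w d * cnj (w d))"
      using orth[of "\<lambda>d. \<Sum>e\<in>J. T d e * y e"] TTy by (simp add: mult.commute)
    also have "\<dots> = of_real (n\<^sup>2)" by (simp add: sum_mult_cnj n2)
    finally show ?thesis unfolding T'z using n by (simp add: w_def)
  qed
  show thesis
    by (rule that[of T'], fact 1, fact 2, fact 3) (simp add: T'z orth)
qed

text \<open>The trace is kept at exactly \<open>m\<close> even if the vectors \<open>y i\<close> are
  linearly dependent, because the bounds on traces against \<open>G\<close> are indexed by the
  rank.\<close>

lemma exists_orth_proj_fixing:
  fixes y :: "nat \<Rightarrow> 'a \<Rightarrow> complex"
  assumes J: "finite J" and "m \<le> card J"
  shows "\<exists>T. orth_proj J T \<and> trace_on J T = of_nat m \<and>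
    (\<forall>i<m. \<forall>c\<in>J. (\<Sum>d\<in>J. T c d * y i d) = y i c)"
  using assms(2)
proof (induction m)
  case 0
  show ?case by (intro exI[of _ "\<lambda>c d. 0"]) (simp add: orth_proj_def trace_on_def)
next
  case (Suc m)
  then obtain T where T: "orth_proj J T" "trace_on J T = of_nat m"
    "\<And>i c. i < m \<Longrightarrow> c \<in> J \<Longrightarrow> (\<Sum>d\<in>J. T c d * y i d) = y i c" by auto
  have "\<exists>T'. orth_proj J T' \<and> trace_on J T' = of_nat m + 1 \<and>
    (\<forall>i<m. \<forall>c\<in>J. (\<Sum>d\<in>J. T' c d * y i d) = y i c) \<and> (\<forall>c\<in>J. (\<Sum>d\<in>J. T' c d * y m d) = y m c)"
  proof (cases "\<forall>c\<in>J. (\<Sum>d\<in>J. T c d * y m d) = y m c")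
    case True
    \<comment> \<open>Here \<open>y m\<close> is already in the range, so the rank is raised along a
      coordinate vector. One outside the range exists, since otherwise the trace would be
      \<open>card J\<close>, which exceeds \<open>m\<close>.\<close>
    have "\<exists>c\<in>J. T c c \<noteq> 1"
    proof (rule ccontr)
      assume "\<not> (\<exists>c\<in>J. T c c \<noteq> 1)"
      then have "trace_on J T = of_nat (card J)" by (simp add: trace_on_def)
      then show False using T(2) Suc.prems by simp
    qed
    then obtain c where c: "c \<in> J" "T c c \<noteq> 1" by blast
    then have "(\<Sum>d\<in>J. T c d * of_bool (d = c)) \<noteq> of_bool (c = c)"
      using J by (simp add: sum_of_bool_mult)
    from J T(1) c(1) this obtain T' where T': "orth_proj J T'" "trace_on J T' = trace_on J T + 1"
      "\<And>z c. (\<And>c. c \<in> J \<Longrightarrow> (\<Sum>d\<in>J. T c d * z d) = z c) \<Longrightarrow> c \<in> J \<Longrightarrow>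
         (\<Sum>d\<in>J. T' c d * z d) = z c"
      by (rule orth_proj_extend) blast
    show ?thesis
    proof (intro exI[of _ T'] conjI allI impI ballI)
      show "(\<Sum>d\<in>J. T' c d * y i d) = y i c" if "i < m" "c \<in> J" for i c
        using that T(3) by (intro T'(3)) simp_all
      show "(\<Sum>d\<in>J. T' c d * y m d) = y m c" if "c \<in> J" for c
        using that True by (intro T'(3)) simp_all
    qed (use T' T in simp_all)
  next
    case False
    then obtain c where "c \<in> J" "(\<Sum>d\<in>J. T c d * y m d) \<noteq> y m c" by blast
    with J T(1) obtain T' where T': "orth_proj J T'" "trace_on J T' = trace_on J T + 1"
      "\<And>c. c \<in> J \<Longrightarrow> (\<Sum>d\<in>J. T' c d * y m d) = y m c"
      "\<And>z c. (\<And>c. c \<in> J \<Longrightarrow> (\<Sum>d\<in>J. T c d * z d) = z c) \<Longrightarrow> c \<in> J \<Longrightarrow>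
         (\<Sum>d\<in>J. T' c d * z d) = z c"
      by (rule orth_proj_extend) blast
    show ?thesis
    proof (intro exI[of _ T'] conjI allI impI ballI)
      show "(\<Sum>d\<in>J. T' c d * y i d) = y i c" if "i < m" "c \<in> J" for i c
        using that T(3) by (intro T'(4)) simp_all
    qed (use T' T in simp_all)
  qed
  then show ?case by (auto simp: less_Suc_eq add.commute)
qed

section \<open>Traces of a Gram matrix against projections\<close>

text \<open>From \<open>T = T T*\<close>: a diagonal entry is the squared length of its row, so it
  is real and nonnegative and vanishes only together with the row.\<close>

lemma orth_proj_diag:
  assumes T: "orth_proj J T" and c: "c \<in> J"
  shows "T c c = of_real (\<Sum>e\<in>J. (cmod (T c e))\<^sup>2)"
proof -
  have "T c c = (\<Sum>e\<in>J. T c e * cnj (T c e))"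
    using orth_proj_idem[OF T c c, symmetric] by (simp add: orth_proj_herm[OF T _ c])
  then show ?thesis by (simp add: sum_mult_cnj)
qed

lemma orth_proj_conjugate_signs:
  assumes T: "orth_proj J T"
    and sg: "\<And>c. c \<in> J \<Longrightarrow> sg c * sg c = 1" "\<And>c. c \<in> J \<Longrightarrow> cnj (sg c) = sg c"
  shows "orth_proj J (\<lambda>c d. sg c * T c d * sg d)"
proof (rule orth_projI)
  fix c d assume cd: "c \<in> J" "d \<in> J"
  show "cnj (sg d * T d c * sg c) = sg c * T c d * sg d"
    using cd by (simp add: sg orth_proj_herm[OF T])
  have "(\<Sum>e\<in>J. sg c * T c e * sg e * (sg e * T e d * sg d)) = (\<Sum>e\<in>J. sg c * (T c e * T e d) * sg d)"
  proof (rule sum.cong[OF refl])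
    fix e assume "e \<in> J"
    have "sg c * T c e * sg e * (sg e * T e d * sg d) = (sg e * sg e) * (sg c * (T c e * T e d) * sg d)"
      by (simp only: mult_ac)
    then show "sg c * T c e * sg e * (sg e * T e d * sg d) = sg c * (T c e * T e d) * sg d"
      using sg(1)[OF \<open>e \<in> J\<close>] by simp
  qed
  also have "\<dots> = sg c * (\<Sum>e\<in>J. T c e * T e d) * sg d"
    by (simp add: sum_distrib_left sum_distrib_right)
  finally show "(\<Sum>e\<in>J. sg c * T c e * sg e * (sg e * T e d * sg d)) = sg c * T c d * sg d"
    using cd by (simp add: orth_proj_idem[OF T])
qed

text \<open>Splitting off from \<open>T\<close> the normalised column \<open>c0\<close> leaves a projection whose range
  is supported off \<open>c0\<close>; this replaces the interlacing argument for singular values.\<close>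

lemma orth_proj_split_column:
  assumes J: "finite J" and T: "orth_proj J T" and c0: "c0 \<in> J" "T c0 c0 \<noteq> 0"
  obtains T' u where "orth_proj (J - {c0}) T'" "trace_on (J - {c0}) T' = trace_on J T - 1"
    "(\<Sum>c\<in>J. (cmod (u c))\<^sup>2) = 1"
    "\<And>G. (\<Sum>c\<in>J. \<Sum>d\<in>J. G c d * T d c) =
       (\<Sum>c\<in>J - {c0}. \<Sum>d\<in>J - {c0}. G c d * T' d c) + (\<Sum>c\<in>J. \<Sum>d\<in>J. cnj (u c) * G c d * u d)"
proof -
  define n where "n = (\<Sum>e\<in>J. (cmod (T c0 e))\<^sup>2)"
  have Tn: "T c0 c0 = of_real n" using orth_proj_diag[OF T c0(1)] by (simp add: n_def)
  have "n \<noteq> 0" using Tn c0(2) by (metis of_real_0)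
  moreover have "n \<ge> 0" unfolding n_def by (rule sum_nonneg) simp
  ultimately have n: "n > 0" by simp
  define u where "u c = T c c0 / of_real (sqrt n)" for c
  define T' where "T' = (\<lambda>c d. T c d - u c * cnj (u d))"
  have sq: "complex_of_real (sqrt n) * complex_of_real (sqrt n) = of_real n"
    using n by (simp flip: of_real_mult)
  have Tu: "(\<Sum>d\<in>J. T c d * u d) = u c" if "c \<in> J" for c
    using orth_proj_idem[OF T that c0(1)] by (simp add: u_def flip: sum_divide_distrib)
  have "(\<Sum>c\<in>J. u c * cnj (u c)) = (\<Sum>c\<in>J. T c0 c * T c c0) / of_real n"
    unfolding sum_divide_distrib
    by (rule sum.cong) (simp_all add: u_def orth_proj_herm[OF T c0(1)] sq)
  also have "\<dots> = 1" using c0 by (simp add: orth_proj_idem[OF T] Tn)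
  finally have uu: "(\<Sum>c\<in>J. u c * cnj (u c)) = 1" .
  have T': "orth_proj J T'" unfolding T'_def by (rule orth_proj_diff[OF T Tu uu])
  \<comment> \<open>The scaling gives \<open>u c0 = sqrt n\<close>, so \<open>u u*\<close> and
    \<open>T\<close> have the same row \<open>c0\<close>; hence \<open>T'\<close> lives on
    \<open>J - {c0}\<close>.\<close>
  have z1: "T' c0 d = 0" if "d \<in> J" for d
    using that c0 n by (simp add: T'_def u_def orth_proj_herm[OF T] sq Tn)
  have z2: "T' d c0 = 0" if "d \<in> J" for d
    using z1[OF that] orth_proj_herm[OF T' that c0(1)] by simp
  have rem: "(\<Sum>c\<in>J. f c) = (\<Sum>c\<in>J - {c0}. f c)" if "f c0 = 0" for f :: "'a \<Rightarrow> complex"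
    using sum.remove[OF J c0(1), of f] that by simp
  have 1: "orth_proj (J - {c0}) T'"
  proof (rule orth_projI)
    fix c d assume "c \<in> J - {c0}" "d \<in> J - {c0}"
    then show "cnj (T' d c) = T' c d" "(\<Sum>e\<in>J - {c0}. T' c e * T' e d) = T' c d"
      using orth_proj_herm[OF T'] orth_proj_idem[OF T', of c d] rem[of "\<lambda>e. T' c e * T' e d"] z1
      by auto
  qed
  have 2: "trace_on (J - {c0}) T' = trace_on J T - 1"
    using rem[of "\<lambda>c. T' c c"] z1[OF c0(1)] uu
    by (simp add: trace_on_def T'_def sum_subtractf)
  have 3: "(\<Sum>c\<in>J. (cmod (u c))\<^sup>2) = 1"
    using uu unfolding sum_mult_cnj by (metis of_real_eq_1_iff)
  have 4: "(\<Sum>c\<in>J. \<Sum>d\<in>J. G c d * T d c) =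
       (\<Sum>c\<in>J - {c0}. \<Sum>d\<in>J - {c0}. G c d * T' d c) + (\<Sum>c\<in>J. \<Sum>d\<in>J. cnj (u c) * G c d * u d)" for G
  proof -
    have "(\<Sum>c\<in>J. \<Sum>d\<in>J. G c d * T d c) =
        (\<Sum>c\<in>J. \<Sum>d\<in>J. G c d * T' d c) + (\<Sum>c\<in>J. \<Sum>d\<in>J. cnj (u c) * G c d * u d)"
      by (simp add: T'_def algebra_simps flip: sum.distrib)
    also have "(\<Sum>c\<in>J. \<Sum>d\<in>J. G c d * T' d c) = (\<Sum>c\<in>J. \<Sum>d\<in>J - {c0}. G c d * T' d c)"
      by (intro sum.cong refl rem) (simp add: z1)
    also have "\<dots> = (\<Sum>c\<in>J - {c0}. \<Sum>d\<in>J - {c0}. G c d * T' d c)"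
      by (rule rem) (simp add: z2)
    finally show ?thesis .
  qed
  show thesis by (rule that[OF 1 2 3 4])
qed

text \<open>One rank-one piece \<open>u u*\<close> is peeled off at a time. It contributes at most
  the largest value of the form on the current index set, and the remainder lives on one index
  fewer, which produces \<open>s (card J - 1)\<close>, \<open>s (card J - 2)\<close> and so on. The
  condition \<open>2 * r \<le> card J\<close> keeps every index set that still has a piece to peel
  at size at least 2, where the bound on the form is available.\<close>

lemma gram_trace_le_lower_half:
  fixes G :: "'a \<Rightarrow> 'a \<Rightarrow> complex" and s :: "nat \<Rightarrow> real"
  assumes "finite J"
    and "\<And>K u. K \<subseteq> J \<Longrightarrow> card K \<ge> 2 \<Longrightarrow>
      Re (\<Sum>c\<in>K. \<Sum>d\<in>K. cnj (u c) * G c d * u d) \<le> (1 + s (card K - 1)) * (\<Sum>c\<in>K. (cmod (u c))\<^sup>2)"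
    and "orth_proj J T" "trace_on J T = of_nat r" "2 * r \<le> card J"
  shows "Re (\<Sum>c\<in>J. \<Sum>d\<in>J. G c d * T d c) \<le> real r + (\<Sum>j=1..r. s (card J - j))"
  using assms
proof (induction r arbitrary: J T)
  case 0
  have "of_real (\<Sum>c\<in>J. \<Sum>e\<in>J. (cmod (T c e))\<^sup>2) = (0::complex)"
    using 0(4) orth_proj_diag[OF 0(3)] by (simp add: trace_on_def)
  then have "(\<Sum>c\<in>J. \<Sum>e\<in>J. (cmod (T c e))\<^sup>2) = 0"
    unfolding of_real_eq_0_iff .
  then have "T d c = 0" if "c \<in> J" "d \<in> J" for c d
    using that 0(1) by (simp add: sum_nonneg_eq_0_iff sum_nonneg)
  then show ?case by simp
next
  case (Suc r)
  have "\<exists>c\<in>J. T c c \<noteq> 0"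
  proof (rule ccontr)
    assume "\<not> ?thesis"
    then have "trace_on J T = 0" by (simp add: trace_on_def)
    then show False using Suc.prems(4) by (metis Suc_neq_Zero of_nat_eq_0_iff)
  qed
  then obtain c0 where c0: "c0 \<in> J" "T c0 c0 \<noteq> 0" by blast
  obtain T' u where
    T': "orth_proj (J - {c0}) T'" "trace_on (J - {c0}) T' = trace_on J T - 1"
    "(\<Sum>c\<in>J. (cmod (u c))\<^sup>2) = 1"
    and split: "\<And>G. (\<Sum>c\<in>J. \<Sum>d\<in>J. G c d * T d c) =
       (\<Sum>c\<in>J - {c0}. \<Sum>d\<in>J - {c0}. G c d * T' d c) + (\<Sum>c\<in>J. \<Sum>d\<in>J. cnj (u c) * G c d * u d)"
    by (rule orth_proj_split_column[OF Suc.prems(1,3) c0]) (rule that)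
  have card: "card (J - {c0}) = card J - 1" using c0 Suc.prems(1) by simp
  have "Re (\<Sum>c\<in>J - {c0}. \<Sum>d\<in>J - {c0}. G c d * T' d c)
      \<le> real r + (\<Sum>j=1..r. s (card (J - {c0}) - j))"
  proof (rule Suc.IH)
    show "trace_on (J - {c0}) T' = of_nat r" using T'(2) Suc.prems(4) by simp
    show "2 * r \<le> card (J - {c0})" using card Suc.prems(5) by simp
    show "Re (\<Sum>c\<in>K. \<Sum>d\<in>K. cnj (u c) * G c d * u d) \<le> (1 + s (card K - 1)) * (\<Sum>c\<in>K. (cmod (u c))\<^sup>2)"
      if "K \<subseteq> J - {c0}" "card K \<ge> 2" for K u
      using that by (intro Suc.prems(2)) auto
  qed (use T' Suc.prems in auto)
  moreover have "Re (\<Sum>c\<in>J. \<Sum>d\<in>J. cnj (u c) * G c d * u d) \<le> 1 + s (card J - 1)"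
    using Suc.prems(2)[of J u] Suc.prems(5) T'(3) by simp
  moreover have "(\<Sum>j=1..Suc r. s (card J - j)) = s (card J - 1) + (\<Sum>j=1..r. s (card J - 1 - j))"
    by (simp add: sum.atLeast1_atMost_eq sum.lessThan_Suc_shift del: sum.lessThan_Suc sum.cl_ivl_Suc)
  ultimately show ?case
    unfolding split card by simp
qed

text \<open>Conjugation by the signs turns \<open>G\<close> into \<open>2 - G\<close>, so the spectrum of \<open>G\<close> is symmetric
  about 1 and the largest \<open>m\<close> eigenvalues are controlled by the largest \<open>card J - m\<close> ones.\<close>

lemma gram_trace_le:
  fixes G :: "'a \<Rightarrow> 'a \<Rightarrow> complex" and s :: "nat \<Rightarrow> real"
  assumes J: "finite J"
    and top: "\<And>K u. K \<subseteq> J \<Longrightarrow> card K \<ge> 2 \<Longrightarrow>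
      Re (\<Sum>c\<in>K. \<Sum>d\<in>K. cnj (u c) * G c d * u d) \<le> (1 + s (card K - 1)) * (\<Sum>c\<in>K. (cmod (u c))\<^sup>2)"
    and sg: "\<And>c. c \<in> J \<Longrightarrow> sg c * sg c = 1" "\<And>c. c \<in> J \<Longrightarrow> cnj (sg c) = sg c"
      "\<And>c d. c \<in> J \<Longrightarrow> d \<in> J \<Longrightarrow> sg c * sg d * G c d = 2 * of_bool (c = d) - G c d"
    and T: "orth_proj J T" "trace_on J T = of_nat m" "m \<le> card J"
  shows "Re (\<Sum>c\<in>J. \<Sum>d\<in>J. G c d * T d c)
    \<le> real m + (\<Sum>j=1..min m (card J - m). s (card J - j))"
proof (cases "2 * m \<le> card J")
  case True
  then have "min m (card J - m) = m" by simp
  then show ?thesis using gram_trace_le_lower_half[OF J top T(1,2) True] by simp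
next
  case False
  define r where "r = card J - m"
  have r: "min m (card J - m) = r" "2 * r \<le> card J" "real r = real (card J) - real m"
    using False T(3) by (auto simp: r_def)
  \<comment> \<open>With D the diagonal matrix of signs, \<open>T' = D (1 - T) D\<close> has rank
    \<open>card J - m\<close>, and D G D = 2 - G gives
    \<open>tr (G T') = tr ((2 - G) (1 - T)) = card J - 2 m + tr (G T)\<close>.\<close>
  define T' where "T' = (\<lambda>c d. sg c * (of_bool (c = d) - T c d) * sg d)"
  have T': "orth_proj J T'"
    unfolding T'_def by (intro orth_proj_conjugate_signs orth_proj_compl J T sg)
  have "T' c c = 1 - T c c" if "c \<in> J" for c
  proof -
    have "T' c c = (sg c * sg c) * (1 - T c c)" by (simp add: T'_def mult_ac)
    then show ?thesis using sg(1)[OF that] by simp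
  qed
  then have trT': "trace_on J T' = of_nat r"
    using T(2,3) by (simp add: trace_on_def sum_subtractf r_def)
  have Gd: "G c c = 1" if "c \<in> J" for c
    using sg(3)[OF that that] sg(1)[OF that] by simp
  have "(\<Sum>c\<in>J. \<Sum>d\<in>J. G c d * T' d c) =
    (\<Sum>c\<in>J. \<Sum>d\<in>J. (2 * of_bool (c = d) - G c d) * (of_bool (d = c) - T d c))"
    unfolding T'_def
  proof (intro sum.cong refl)
    fix c d assume "c \<in> J" "d \<in> J"
    then show "G c d * (sg d * (of_bool (d = c) - T d c) * sg c) =
      (2 * of_bool (c = d) - G c d) * (of_bool (d = c) - T d c)"
      using sg(3)[of c d] by (metis mult.assoc mult.commute)
  qed
  also have "\<dots> = (\<Sum>c\<in>J. (\<Sum>d\<in>J. of_bool (c = d) * (2 * of_bool (d = c)))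
      - (\<Sum>d\<in>J. of_bool (c = d) * (2 * T d c))
      - (\<Sum>d\<in>J. of_bool (d = c) * G c d) + (\<Sum>d\<in>J. G c d * T d c))"
    by (simp add: algebra_simps flip: sum.distrib sum_subtractf)
  also have "\<dots> = (\<Sum>c\<in>J. 2 - 2 * T c c - G c c + (\<Sum>d\<in>J. G c d * T d c))"
    using J by (intro sum.cong refl) (simp only: sum_of_bool_mult, simp)
  also have "\<dots> = of_nat (card J) - 2 * of_nat m + (\<Sum>c\<in>J. \<Sum>d\<in>J. G c d * T d c)"
    using T(2) by (simp add: sum.distrib sum_subtractf Gd trace_on_def flip: sum_distrib_left)
  finally have "Re (\<Sum>c\<in>J. \<Sum>d\<in>J. G c d * T d c) =
      Re (\<Sum>c\<in>J. \<Sum>d\<in>J. G c d * T' d c) - real (card J) + 2 * real m"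
    by simp
  also have "\<dots> \<le> real m + (\<Sum>j=1..r. s (card J - j))"
    using gram_trace_le_lower_half[OF J top T' trT' r(2)] r(3) by simp
  finally show ?thesis by (simp only: r(1))
qed

text \<open>Ky Fan's principle, transported from the operator \<open>V V*\<close> on the ambient space to the
  Gram matrix \<open>V* V\<close> of the vectors \<open>v c\<close>.\<close>

lemma sum_sq_coords_le_gram_trace:
  fixes v :: "'a \<Rightarrow> nat \<Rightarrow> complex"
  assumes J: "finite J" and m: "m \<le> card J" "m \<le> N"
    and G: "\<And>c d. c \<in> J \<Longrightarrow> d \<in> J \<Longrightarrow> G c d = (\<Sum>i<N. cnj (v c i) * v d i)"
  obtains T where "orth_proj J T" "trace_on J T = of_nat m"
    "(\<Sum>i<m. \<Sum>c\<in>J. (cmod (v c i))\<^sup>2) \<le> Re (\<Sum>c\<in>J. \<Sum>d\<in>J. G c d * T d c)"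
proof -
  obtain T where T: "orth_proj J T" "trace_on J T = of_nat m"
    and fix_v: "\<And>i c. i < m \<Longrightarrow> c \<in> J \<Longrightarrow> (\<Sum>d\<in>J. T c d * cnj (v d i)) = cnj (v c i)"
    using exists_orth_proj_fixing[OF J m(1), of "\<lambda>i d. cnj (v d i)"] by auto
  \<comment> \<open>The quadratic form of \<open>T\<close> at the vector with entries
    \<open>cnj (v d i)\<close>. It is nonnegative for every \<open>i\<close>, equals the full
    squared length where \<open>T\<close> fixes that vector, that is for \<open>i < m\<close>, and
    its sum over \<open>i < N\<close> is the trace of \<open>G T\<close>.\<close>
  define f where "f i = (\<Sum>d\<in>J. v d i * (\<Sum>c\<in>J. T d c * cnj (v c i)))" for i
  have f_sq: "f i = of_real (\<Sum>e\<in>J. (cmod (\<Sum>c\<in>J. T e c * cnj (v c i)))\<^sup>2)" for i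
  proof -
    have "f i = (\<Sum>d\<in>J. v d i * (\<Sum>c\<in>J. (\<Sum>e\<in>J. T d e * T e c) * cnj (v c i)))"
      unfolding f_def by (intro sum.cong refl arg_cong2[of _ _ _ _ "(*)"])
        (simp_all add: orth_proj_idem[OF T(1)])
    also have "\<dots> = (\<Sum>d\<in>J. \<Sum>c\<in>J. \<Sum>e\<in>J. (T e c * cnj (v c i)) * (v d i * T d e))"
      by (simp add: sum_distrib_left sum_distrib_right mult_ac)
    also have "\<dots> = (\<Sum>d\<in>J. \<Sum>e\<in>J. \<Sum>c\<in>J. (T e c * cnj (v c i)) * (v d i * T d e))"
      by (intro sum.cong refl sum.swap)
    also have "\<dots> = (\<Sum>e\<in>J. \<Sum>d\<in>J. \<Sum>c\<in>J. (T e c * cnj (v c i)) * (v d i * T d e))"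
      by (rule sum.swap)
    also have "\<dots> = (\<Sum>e\<in>J. (\<Sum>c\<in>J. T e c * cnj (v c i)) * (\<Sum>d\<in>J. v d i * T d e))"
      by (simp add: sum_distrib_left sum_distrib_right)
    also have "\<dots> = (\<Sum>e\<in>J. (\<Sum>c\<in>J. T e c * cnj (v c i)) * cnj (\<Sum>c\<in>J. T e c * cnj (v c i)))"
      unfolding cnj_sum complex_cnj_mult complex_cnj_cnj
      by (intro sum.cong refl arg_cong2[of "sum _ _" _ "sum _ _" _ "(*)"])
        (simp add: orth_proj_herm[OF T(1)] mult.commute)
    finally show ?thesis by (simp only: sum_mult_cnj)
  qed
  have "(\<Sum>c\<in>J. \<Sum>d\<in>J. G c d * T d c) = (\<Sum>c\<in>J. \<Sum>d\<in>J. \<Sum>i<N. v d i * (T d c * cnj (v c i)))"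
    by (intro sum.cong refl) (simp add: G sum_distrib_left sum_distrib_right mult_ac)
  also have "\<dots> = (\<Sum>c\<in>J. \<Sum>i<N. \<Sum>d\<in>J. v d i * (T d c * cnj (v c i)))"
    by (intro sum.cong refl sum.swap)
  also have "\<dots> = (\<Sum>i<N. \<Sum>c\<in>J. \<Sum>d\<in>J. v d i * (T d c * cnj (v c i)))"
    by (rule sum.swap)
  also have "\<dots> = (\<Sum>i<N. \<Sum>d\<in>J. \<Sum>c\<in>J. v d i * (T d c * cnj (v c i)))"
    by (intro sum.cong refl sum.swap)
  also have "\<dots> = (\<Sum>i<N. f i)"
    by (simp add: f_def sum_distrib_left)
  finally have tr: "Re (\<Sum>c\<in>J. \<Sum>d\<in>J. G c d * T d c) = (\<Sum>i<N. Re (f i))" by simp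
  have "(\<Sum>i<m. \<Sum>c\<in>J. (cmod (v c i))\<^sup>2) = (\<Sum>i<m. Re (f i))"
    by (intro sum.cong refl) (simp add: f_sq fix_v)
  also have "\<dots> \<le> (\<Sum>i<N. Re (f i))"
    using m(2) by (intro sum_mono2) (auto simp: f_sq sum_nonneg)
  finally show thesis using that[OF T] tr by simp
qed

section \<open>Norms of submatrices\<close>

lemma pick_bij_betw:
  assumes "finite A"
  shows "bij_betw (pick A) {..<card A} A"
proof -
  have "inj_on (pick A) {..<card A}"
    by (rule inj_onI) (metis lessThan_iff less_irrefl linorder_neqE_nat pick_mono_le)
  moreover have "pick A ` {..<card A} \<subseteq> A" by (auto intro: pick_in_set_le)
  ultimately show ?thesis
    using assms by (metis bij_betw_def card_image card_lessThan card_subset_eq)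
qed

lemma mat_adjoint_dim [simp]:
  "dim_row (mat_adjoint A) = dim_col A" "dim_col (mat_adjoint A) = dim_row A"
  by (simp_all add: mat_adjoint_def)

lemma mat_adjoint_index:
  "i < dim_col A \<Longrightarrow> j < dim_row A \<Longrightarrow> mat_adjoint A $$ (i, j) = conjugate (A $$ (j, i))"
  by (simp add: mat_adjoint_def mat_of_rows_index)

lemma mat_mult_index_sum:
  assumes "A \<in> carrier_mat n m" "B \<in> carrier_mat m l" "i < n" "j < l"
  shows "(A * B) $$ (i, j) = (\<Sum>k<m. A $$ (i, k) * B $$ (k, j))"
  using assms by (auto simp: scalar_prod_def lessThan_atLeast0)

lemma unitary_cols:
  assumes "unitary_mat N U" "i < N" "j < N"
  shows "(\<Sum>a<N. cnj (U $$ (a, i)) * U $$ (a, j)) = of_bool (i = j)"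
proof -
  have U: "U \<in> carrier_mat N N" "mat_adjoint U * U = 1\<^sub>m N"
    using assms(1) by (auto simp: unitary_mat_def)
  then have "(mat_adjoint U * U) $$ (i, j) = (\<Sum>a<N. mat_adjoint U $$ (i, a) * U $$ (a, j))"
    using assms by (intro mat_mult_index_sum) auto
  also have "\<dots> = (\<Sum>a<N. cnj (U $$ (a, i)) * U $$ (a, j))"
    using U assms by (intro sum.cong) (auto simp: mat_adjoint_index)
  finally have "1\<^sub>m N $$ (i, j) = (\<Sum>a<N. cnj (U $$ (a, i)) * U $$ (a, j))"
    by (simp only: U(2))
  from this[symmetric] show ?thesis using assms by simp
qed

text \<open>The operator norm of a block whose entries keep their original indices. Passing to
  larger \<open>A\<close> and \<open>B\<close> is then an extension of \<open>x\<close> by zero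
  instead of a renumbering through \<open>pick\<close>.\<close>

definition minor_norm :: "complex mat \<Rightarrow> nat set \<Rightarrow> nat set \<Rightarrow> real" where
  "minor_norm U A B = Sup {sqrt (\<Sum>a\<in>A. (cmod (\<Sum>b\<in>B. U $$ (a, b) * x b))\<^sup>2) |x.
     (\<Sum>b\<in>B. (cmod (x b))\<^sup>2) \<le> 1}"

lemma op_norm_submatrix:
  assumes U: "U \<in> carrier_mat N N" and AB: "A \<subseteq> {..<N}" "B \<subseteq> {..<N}"
  shows "op_norm (submatrix U A B) = minor_norm U A B"
proof -
  have fin: "finite A" "finite B" using AB by (auto intro: finite_subset)
  have sets: "{i. i < dim_row U \<and> i \<in> A} = A" "{i. i < dim_col U \<and> i \<in> B} = B"
    using U AB by auto
  let ?M = "submatrix U A B"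
  have dims: "dim_row ?M = card A" "dim_col ?M = card B"
    by (simp_all add: dim_submatrix sets)
  note bA = pick_bij_betw[OF fin(1)] and bB = pick_bij_betw[OF fin(2)]
  have vnorm: "vnorm2 v = sqrt (\<Sum>b\<in>B. (cmod (x b))\<^sup>2)"
    and Mv: "vnorm2 (?M *\<^sub>v v) = sqrt (\<Sum>a\<in>A. (cmod (\<Sum>b\<in>B. U $$ (a, b) * x b))\<^sup>2)"
    if v: "v \<in> carrier_vec (card B)" "\<And>j. j < card B \<Longrightarrow> v $ j = x (pick B j)" for v x
  proof -
    show "vnorm2 v = sqrt (\<Sum>b\<in>B. (cmod (x b))\<^sup>2)"
      unfolding vnorm2_def sum.reindex_bij_betw[OF bB, symmetric] using v by simp
    have "(?M *\<^sub>v v) $ i = (\<Sum>b\<in>B. U $$ (pick A i, b) * x b)" if i: "i < card A" for i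
    proof -
      have "(?M *\<^sub>v v) $ i = (\<Sum>j<card B. ?M $$ (i, j) * v $ j)"
        using i v dims by (simp add: scalar_prod_def lessThan_atLeast0)
      also have "\<dots> = (\<Sum>j<card B. U $$ (pick A i, pick B j) * x (pick B j))"
        using i v by (intro sum.cong) (simp_all add: submatrix_index sets)
      finally show ?thesis
        by (simp add: sum.reindex_bij_betw[OF bB, of "\<lambda>b. U $$ (pick A i, b) * x b"])
    qed
    then show "vnorm2 (?M *\<^sub>v v) = sqrt (\<Sum>a\<in>A. (cmod (\<Sum>b\<in>B. U $$ (a, b) * x b))\<^sup>2)"
      unfolding vnorm2_def sum.reindex_bij_betw[OF bA, symmetric] using dims by simp
  qed
  have "{vnorm2 (?M *\<^sub>v v) | v. v \<in> carrier_vec (dim_col ?M) \<and> vnorm2 v \<le> 1} =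
    {sqrt (\<Sum>a\<in>A. (cmod (\<Sum>b\<in>B. U $$ (a, b) * x b))\<^sup>2) |x. (\<Sum>b\<in>B. (cmod (x b))\<^sup>2) \<le> 1}"
    (is "?L = ?R")
  proof (intro equalityI subsetI)
    fix r assume "r \<in> ?L"
    then obtain v where v: "r = vnorm2 (?M *\<^sub>v v)" "v \<in> carrier_vec (card B)" "vnorm2 v \<le> 1"
      using dims by auto
    define x where "x b = v $ inv_into {..<card B} (pick B) b" for b
    have x: "v $ j = x (pick B j)" if "j < card B" for j
      using that bB by (simp add: x_def bij_betw_def)
    show "r \<in> ?R" using v(1,3) vnorm[OF v(2) x] Mv[OF v(2) x] by auto
  next
    fix r assume "r \<in> ?R"
    then obtain x where x: "r = sqrt (\<Sum>a\<in>A. (cmod (\<Sum>b\<in>B. U $$ (a, b) * x b))\<^sup>2)"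
      "(\<Sum>b\<in>B. (cmod (x b))\<^sup>2) \<le> 1" by auto
    define v where "v = vec (card B) (\<lambda>j. x (pick B j))"
    have v: "v \<in> carrier_vec (card B)" "v $ j = x (pick B j)" if "j < card B" for j
      using that by (simp_all add: v_def)
    have v1: "v \<in> carrier_vec (card B)" by (simp add: v_def)
    have "r = vnorm2 (?M *\<^sub>v v)" "vnorm2 v \<le> 1"
      using x vnorm[OF v1 v(2)] Mv[OF v1 v(2)] by simp_all
    then show "r \<in> ?L" using v1 dims by auto
  qed
  then show ?thesis by (simp add: op_norm_def minor_norm_def)
qed

text \<open>Expanding the square leaves only the diagonal Gram entries. It serves for blocks of full
  columns of \<open>U\<close> and, with the two indices exchanged, for the rows of
  \<open>U\<close>.\<close>

lemma sum_cmod_sq_orthonormal_cols: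
  assumes B: "finite B"
    and u: "\<And>b b'. b \<in> B \<Longrightarrow> b' \<in> B \<Longrightarrow> (\<Sum>a\<in>I. cnj (u a b) * u a b') = of_bool (b = b')"
  shows "(\<Sum>a\<in>I. (cmod (\<Sum>b\<in>B. u a b * x b))\<^sup>2) = (\<Sum>b\<in>B. (cmod (x b))\<^sup>2)"
proof -
  have "complex_of_real (\<Sum>a\<in>I. (cmod (\<Sum>b\<in>B. u a b * x b))\<^sup>2)
      = (\<Sum>a\<in>I. (\<Sum>b'\<in>B. u a b' * x b') * cnj (\<Sum>b\<in>B. u a b * x b))"
    by (simp add: complex_norm_square flip: of_real_power)
  also have "\<dots> = (\<Sum>a\<in>I. \<Sum>b'\<in>B. \<Sum>b\<in>B. (cnj (u a b) * u a b') * (cnj (x b) * x b'))"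
    by (simp add: sum_product mult_ac)
  also have "\<dots> = (\<Sum>b'\<in>B. \<Sum>a\<in>I. \<Sum>b\<in>B. (cnj (u a b) * u a b') * (cnj (x b) * x b'))"
    by (rule sum.swap)
  also have "\<dots> = (\<Sum>b'\<in>B. \<Sum>b\<in>B. \<Sum>a\<in>I. (cnj (u a b) * u a b') * (cnj (x b) * x b'))"
    by (intro sum.cong refl sum.swap)
  also have "\<dots> = (\<Sum>b'\<in>B. \<Sum>b\<in>B. of_bool (b = b') * (cnj (x b) * x b'))"
    by (intro sum.cong refl) (simp add: u flip: sum_distrib_right)
  also have "\<dots> = (\<Sum>b\<in>B. cnj (x b) * x b)"
    using B by (intro sum.cong refl) (simp add: of_bool_def if_distrib[of "\<lambda>x. x * _"] cong: if_cong)
  also have "\<dots> = complex_of_real (\<Sum>b\<in>B. (cmod (x b))\<^sup>2)"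
    by (simp add: complex_norm_square mult.commute flip: of_real_power)
  finally show ?thesis unfolding of_real_eq_iff .
qed

section \<open>Blocks of a unitary matrix\<close>

context
  fixes N :: nat and U :: "complex mat"
  assumes U: "unitary_mat N U"
begin

text \<open>Deleting rows can only shorten the image, and full columns act isometrically. The bound
  also makes the set in \<open>minor_norm\<close> bounded, so that its \<open>Sup\<close> is a
  genuine supremum.\<close>

lemma minor_contraction:
  assumes AB: "A \<subseteq> {..<N}" "B \<subseteq> {..<N}"
  shows "(\<Sum>a\<in>A. (cmod (\<Sum>b\<in>B. U $$ (a, b) * x b))\<^sup>2) \<le> (\<Sum>b\<in>B. (cmod (x b))\<^sup>2)"
proof -
  have "(\<Sum>a\<in>A. (cmod (\<Sum>b\<in>B. U $$ (a, b) * x b))\<^sup>2) \<le> (\<Sum>a<N. (cmod (\<Sum>b\<in>B. U $$ (a, b) * x b))\<^sup>2)"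
    using AB by (intro sum_mono2) auto
  also have "\<dots> = (\<Sum>b\<in>B. (cmod (x b))\<^sup>2)"
    using AB by (intro sum_cmod_sq_orthonormal_cols unitary_cols[OF U]) (auto intro: finite_subset)
  finally show ?thesis .
qed

lemma minor_norm_upper:
  assumes AB: "A \<subseteq> {..<N}" "B \<subseteq> {..<N}" and x: "(\<Sum>b\<in>B. (cmod (x b))\<^sup>2) \<le> 1"
  shows "sqrt (\<Sum>a\<in>A. (cmod (\<Sum>b\<in>B. U $$ (a, b) * x b))\<^sup>2) \<le> minor_norm U A B"
  unfolding minor_norm_def
proof (rule cSup_upper)
  show "bdd_above {sqrt (\<Sum>a\<in>A. (cmod (\<Sum>b\<in>B. U $$ (a, b) * x b))\<^sup>2) |x. (\<Sum>b\<in>B. (cmod (x b))\<^sup>2) \<le> 1}"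
    by (rule bdd_aboveI[of _ 1]) (auto intro: order_trans[OF minor_contraction[OF AB]])
  show "sqrt (\<Sum>a\<in>A. (cmod (\<Sum>b\<in>B. U $$ (a, b) * x b))\<^sup>2) \<in>
    {sqrt (\<Sum>a\<in>A. (cmod (\<Sum>b\<in>B. U $$ (a, b) * x b))\<^sup>2) |x. (\<Sum>b\<in>B. (cmod (x b))\<^sup>2) \<le> 1}"
    by (intro CollectI exI[of _ x] conjI refl x)
qed

lemma minor_norm_least:
  assumes "\<And>x. (\<Sum>b\<in>B. (cmod (x b))\<^sup>2) \<le> 1 \<Longrightarrow>
    sqrt (\<Sum>a\<in>A. (cmod (\<Sum>b\<in>B. U $$ (a, b) * x b))\<^sup>2) \<le> z"
  shows "minor_norm U A B \<le> z"
  unfolding minor_norm_def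
proof (rule cSup_least)
  show "{sqrt (\<Sum>a\<in>A. (cmod (\<Sum>b\<in>B. U $$ (a, b) * x b))\<^sup>2) |x. (\<Sum>b\<in>B. (cmod (x b))\<^sup>2) \<le> 1} \<noteq> {}"
    by (auto intro!: exI[of _ "\<lambda>_. 0"])
  fix r assume "r \<in> {sqrt (\<Sum>a\<in>A. (cmod (\<Sum>b\<in>B. U $$ (a, b) * x b))\<^sup>2) |x. (\<Sum>b\<in>B. (cmod (x b))\<^sup>2) \<le> 1}"
  then show "r \<le> z" by clarify (rule assms)
qed

lemma minor_norm_le_1:
  assumes AB: "A \<subseteq> {..<N}" "B \<subseteq> {..<N}"
  shows "minor_norm U A B \<le> 1"
proof (rule minor_norm_least)
  fix x assume "(\<Sum>b\<in>B. (cmod (x b))\<^sup>2) \<le> 1"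
  then show "sqrt (\<Sum>a\<in>A. (cmod (\<Sum>b\<in>B. U $$ (a, b) * x b))\<^sup>2) \<le> 1"
    using minor_contraction[OF AB, of x] by simp
qed

lemma minor_norm_nonneg:
  assumes AB: "A \<subseteq> {..<N}" "B \<subseteq> {..<N}"
  shows "0 \<le> minor_norm U A B"
  using minor_norm_upper[OF AB, of "\<lambda>_. 0"] by simp

lemma minor_norm_mono:
  assumes AB: "A \<subseteq> A'" "A' \<subseteq> {..<N}" "B \<subseteq> B'" "B' \<subseteq> {..<N}"
  shows "minor_norm U A B \<le> minor_norm U A' B'"
proof (rule minor_norm_least)
  fix x assume x: "(\<Sum>b\<in>B. (cmod (x b))\<^sup>2) \<le> 1"
  have fin: "finite A'" "finite B'" using AB by (auto intro: finite_subset)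
  define y where "y b = (if b \<in> B then x b else 0)" for b
  have B: "(\<Sum>b\<in>B'. U $$ (a, b) * y b) = (\<Sum>b\<in>B. U $$ (a, b) * x b)" for a
    using AB fin by (intro sum.mono_neutral_cong_right) (auto simp: y_def)
  have "(\<Sum>b\<in>B'. (cmod (y b))\<^sup>2) = (\<Sum>b\<in>B. (cmod (x b))\<^sup>2)"
    using AB fin by (intro sum.mono_neutral_cong_right) (auto simp: y_def)
  then have "sqrt (\<Sum>a\<in>A'. (cmod (\<Sum>b\<in>B'. U $$ (a, b) * y b))\<^sup>2) \<le> minor_norm U A' B'"
    using x AB by (intro minor_norm_upper) auto
  moreover have "sqrt (\<Sum>a\<in>A. (cmod (\<Sum>b\<in>B. U $$ (a, b) * x b))\<^sup>2) \<le>
      sqrt (\<Sum>a\<in>A'. (cmod (\<Sum>b\<in>B'. U $$ (a, b) * y b))\<^sup>2)"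
    unfolding B using AB fin by (intro real_sqrt_le_mono sum_mono2) auto
  ultimately show "sqrt (\<Sum>a\<in>A. (cmod (\<Sum>b\<in>B. U $$ (a, b) * x b))\<^sup>2) \<le> minor_norm U A' B'"
    by (rule order_trans[rotated])
qed

lemma minor_norm_apply:
  assumes AB: "A \<subseteq> {..<N}" "B \<subseteq> {..<N}"
  shows "(\<Sum>a\<in>A. (cmod (\<Sum>b\<in>B. U $$ (a, b) * x b))\<^sup>2) \<le> (minor_norm U A B)\<^sup>2 * (\<Sum>b\<in>B. (cmod (x b))\<^sup>2)"
proof (cases "(\<Sum>b\<in>B. (cmod (x b))\<^sup>2) = 0")
  case True
  then show ?thesis using minor_contraction[OF AB, of x] by simp
next
  case False
  define n where "n = sqrt (\<Sum>b\<in>B. (cmod (x b))\<^sup>2)"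
  have n: "n > 0" "n\<^sup>2 = (\<Sum>b\<in>B. (cmod (x b))\<^sup>2)"
    using False by (auto simp: n_def sum_nonneg less_le)
  have "(\<Sum>b\<in>B. (cmod (x b / n))\<^sup>2) = (\<Sum>b\<in>B. (cmod (x b))\<^sup>2) / n\<^sup>2"
    using n(1) by (simp add: norm_divide power_divide flip: sum_divide_distrib)
  then have "(\<Sum>b\<in>B. (cmod (x b / n))\<^sup>2) = 1"
    unfolding n(2)[symmetric] using n(1) by simp
  then have "sqrt (\<Sum>a\<in>A. (cmod (\<Sum>b\<in>B. U $$ (a, b) * (x b / n)))\<^sup>2) \<le> minor_norm U A B"
    by (intro minor_norm_upper AB) simp
  moreover have "(\<Sum>a\<in>A. (cmod (\<Sum>b\<in>B. U $$ (a, b) * (x b / n)))\<^sup>2) =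
      (\<Sum>a\<in>A. (cmod (\<Sum>b\<in>B. U $$ (a, b) * x b))\<^sup>2) / n\<^sup>2"
    using n(1) by (simp add: norm_divide power_divide flip: sum_divide_distrib)
  ultimately have "sqrt ((\<Sum>a\<in>A. (cmod (\<Sum>b\<in>B. U $$ (a, b) * x b))\<^sup>2) / n\<^sup>2) \<le> minor_norm U A B"
    by (simp only:)
  then have "(\<Sum>a\<in>A. (cmod (\<Sum>b\<in>B. U $$ (a, b) * x b))\<^sup>2) / n\<^sup>2 \<le> (minor_norm U A B)\<^sup>2"
    by (rule sqrt_le_D)
  then show ?thesis
    unfolding n(2)[symmetric] using n(1) by (simp add: pos_divide_le_eq)
qed

text \<open>Uses \<open>2 |y| |z| \<le> s |y|^2 + |z|^2 / s\<close> entrywise, with the norm itself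
  as the weight \<open>s\<close>; the bound of the total \<open>|z|^2\<close> by \<open>s^2\<close>
  times that of \<open>|x|^2\<close> then restores the factor \<open>s\<close>. The left side is how
  the two off-diagonal blocks enter a quadratic form of the Gram matrix.\<close>

lemma minor_form_le:
  assumes AB: "A \<subseteq> {..<N}" "B \<subseteq> {..<N}"
  shows "2 * Re (\<Sum>a\<in>A. cnj (y a) * (\<Sum>b\<in>B. U $$ (a, b) * x b))
    \<le> minor_norm U A B * ((\<Sum>a\<in>A. (cmod (y a))\<^sup>2) + (\<Sum>b\<in>B. (cmod (x b))\<^sup>2))"
proof -
  define s where "s = minor_norm U A B"
  define z where "z a = (\<Sum>b\<in>B. U $$ (a, b) * x b)" for a
  have fin: "finite A" using AB by (auto intro: finite_subset)
  have s: "s \<ge> 0" unfolding s_def by (rule minor_norm_nonneg[OF AB])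
  have z: "(\<Sum>a\<in>A. (cmod (z a))\<^sup>2) \<le> s\<^sup>2 * (\<Sum>b\<in>B. (cmod (x b))\<^sup>2)"
    unfolding s_def z_def by (rule minor_norm_apply[OF AB])
  have "2 * Re (\<Sum>a\<in>A. cnj (y a) * z a) \<le> s * ((\<Sum>a\<in>A. (cmod (y a))\<^sup>2) + (\<Sum>b\<in>B. (cmod (x b))\<^sup>2))"
  proof (cases "s = 0")
    case True
    have "(\<Sum>a\<in>A. (cmod (z a))\<^sup>2) \<ge> 0" by (intro sum_nonneg) simp
    then have "\<forall>a\<in>A. z a = 0"
      using z True fin by (simp add: sum_nonneg_eq_0_iff)
    then show ?thesis using True by simp
  next
    case False
    then have s: "s > 0" using s by simp
    have pt: "2 * Re (cnj (y a) * z a) \<le> s * (cmod (y a))\<^sup>2 + (cmod (z a))\<^sup>2 / s" for a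
    proof -
      have "Re (cnj (y a) * z a) \<le> cmod (y a) * cmod (z a)"
        by (metis complex_Re_le_cmod complex_mod_cnj norm_mult)
      moreover have "s * (2 * (cmod (y a) * cmod (z a))) \<le> s * (s * (cmod (y a))\<^sup>2 + (cmod (z a))\<^sup>2 / s)"
        using s sum_squares_bound[of "s * cmod (y a)" "cmod (z a)"]
        by (simp add: algebra_simps power2_eq_square)
      then have "2 * (cmod (y a) * cmod (z a)) \<le> s * (cmod (y a))\<^sup>2 + (cmod (z a))\<^sup>2 / s"
        using s by simp
      ultimately show ?thesis by linarith
    qed
    have "2 * Re (\<Sum>a\<in>A. cnj (y a) * z a) = (\<Sum>a\<in>A. 2 * Re (cnj (y a) * z a))"
      by (simp only: Re_sum sum_distrib_left)
    also have "\<dots> \<le> (\<Sum>a\<in>A. s * (cmod (y a))\<^sup>2 + (cmod (z a))\<^sup>2 / s)"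
      by (intro sum_mono pt)
    also have "\<dots> = s * (\<Sum>a\<in>A. (cmod (y a))\<^sup>2) + (\<Sum>a\<in>A. (cmod (z a))\<^sup>2) / s"
      by (simp add: sum.distrib sum_distrib_left sum_divide_distrib)
    also have "\<dots> \<le> s * (\<Sum>a\<in>A. (cmod (y a))\<^sup>2) + (s\<^sup>2 * (\<Sum>b\<in>B. (cmod (x b))\<^sup>2)) / s"
      using z s by (intro add_left_mono divide_right_mono) auto
    also have "\<dots> = s * ((\<Sum>a\<in>A. (cmod (y a))\<^sup>2) + (\<Sum>b\<in>B. (cmod (x b))\<^sup>2))"
      using s by (simp add: power2_eq_square algebra_simps)
    finally show ?thesis .
  qed
  then show ?thesis by (simp add: s_def z_def)
qed

section \<open>The maximal block norms \<open>s_val\<close>\<close>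

lemma s_val_eq: "s_val N U k = Max {minor_norm U R C | R C.
    R \<subseteq> {..<N} \<and> C \<subseteq> {..<N} \<and> R \<noteq> {} \<and> C \<noteq> {} \<and> card R + card C = k + 1}"
proof -
  have "U \<in> carrier_mat N N" using U by (simp add: unitary_mat_def)
  then show ?thesis
    unfolding s_val_def by (metis (no_types, lifting) op_norm_submatrix)
qed

lemma finite_minor_norms: "finite {minor_norm U R C | R C.
    R \<subseteq> {..<N} \<and> C \<subseteq> {..<N} \<and> R \<noteq> {} \<and> C \<noteq> {} \<and> card R + card C = k + 1}"
  by (rule finite_subset[of _ "(\<lambda>(R, C). minor_norm U R C) ` (Pow {..<N} \<times> Pow {..<N})"]) auto

lemma minor_norm_le_s_val:
  assumes "R \<subseteq> {..<N}" "C \<subseteq> {..<N}" "R \<noteq> {}" "C \<noteq> {}" "card R + card C = k + 1"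
  shows "minor_norm U R C \<le> s_val N U k"
  unfolding s_val_eq using assms by (intro Max_ge finite_minor_norms) blast

lemma s_val_attained:
  assumes k: "1 \<le> k" "k < 2 * N"
  obtains R C where "R \<subseteq> {..<N}" "C \<subseteq> {..<N}" "R \<noteq> {}" "C \<noteq> {}" "card R + card C = k + 1"
    "s_val N U k = minor_norm U R C"
proof -
  define r where "r = min N k"
  have "minor_norm U {..<r} {..<k + 1 - r} \<in> {minor_norm U R C | R C.
    R \<subseteq> {..<N} \<and> C \<subseteq> {..<N} \<and> R \<noteq> {} \<and> C \<noteq> {} \<and> card R + card C = k + 1}"
  proof (intro CollectI exI conjI)
    show "{..<r} \<noteq> {}" "{..<k + 1 - r} \<noteq> {}" using k by (auto simp: r_def lessThan_empty_iff)
  qed (use k in \<open>auto simp: r_def\<close>)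
  then have "s_val N U k \<in> {minor_norm U R C | R C.
    R \<subseteq> {..<N} \<and> C \<subseteq> {..<N} \<and> R \<noteq> {} \<and> C \<noteq> {} \<and> card R + card C = k + 1}"
    unfolding s_val_eq by (intro Max_in finite_minor_norms) blast
  then show thesis using that by blast
qed

lemma s_val_le_1: "1 \<le> k \<Longrightarrow> k < 2 * N \<Longrightarrow> s_val N U k \<le> 1"
  by (metis s_val_attained minor_norm_le_1)

lemma s_val_nonneg: "1 \<le> k \<Longrightarrow> k < 2 * N \<Longrightarrow> 0 \<le> s_val N U k"
  by (metis s_val_attained minor_norm_nonneg)

text \<open>A maximizing block has \<open>k + 1 < 2 * N\<close> rows and columns together, so there
  is room for one more row or column, and enlarging a block does not lower its norm.\<close>

lemma s_val_Suc_mono: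
  assumes k: "1 \<le> k" "Suc k < 2 * N"
  shows "s_val N U k \<le> s_val N U (Suc k)"
proof -
  obtain R C where RC: "R \<subseteq> {..<N}" "C \<subseteq> {..<N}" "R \<noteq> {}" "C \<noteq> {}" "card R + card C = k + 1"
    "s_val N U k = minor_norm U R C"
    using s_val_attained[of k] k by auto
  have fin: "finite R" "finite C" using RC by (auto intro: finite_subset)
  have "R \<noteq> {..<N} \<or> C \<noteq> {..<N}" using RC(5) k by auto
  then consider a where "a < N" "a \<notin> R" | b where "b < N" "b \<notin> C" using RC by blast
  then show ?thesis
  proof cases
    case 1
    have "minor_norm U R C \<le> minor_norm U (insert a R) C" using RC 1 by (intro minor_norm_mono) auto
    also have "\<dots> \<le> s_val N U (Suc k)" using RC 1 fin by (intro minor_norm_le_s_val) auto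
    finally show ?thesis using RC by simp
  next
    case 2
    have "minor_norm U R C \<le> minor_norm U R (insert b C)" using RC 2 by (intro minor_norm_mono) auto
    also have "\<dots> \<le> s_val N U (Suc k)" using RC 2 fin by (intro minor_norm_le_s_val) auto
    finally show ?thesis using RC by simp
  qed
qed

text \<open>From \<open>k = N\<close> on, an admissible block can contain a full column of
  \<open>U\<close>, which is a unit vector; the witness is the first coordinate vector.\<close>

lemma s_val_eq_1:
  assumes k: "N \<le> k" "k < 2 * N"
  shows "s_val N U k = 1"
proof -
  have "(\<Sum>a<N. (cmod (\<Sum>b<k + 1 - N. U $$ (a, b) * of_bool (b = 0)))\<^sup>2) =
      (\<Sum>b<k + 1 - N. (cmod (of_bool (b = 0)))\<^sup>2)"
    using k by (intro sum_cmod_sq_orthonormal_cols unitary_cols[OF U]) auto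
  also have "\<dots> = (\<Sum>b<k + 1 - N. of_bool (b = 0))" by (intro sum.cong) auto
  also have "\<dots> = 1" using k by (simp add: of_bool_def)
  finally have "1 = sqrt (\<Sum>a<N. (cmod (\<Sum>b<k + 1 - N. U $$ (a, b) * of_bool (b = 0)))\<^sup>2)" by simp
  also have "\<dots> \<le> minor_norm U {..<N} {..<k + 1 - N}"
    using k by (intro minor_norm_upper) (auto simp: of_bool_def if_distrib[of cmod] if_distrib[of "\<lambda>x. x\<^sup>2"] cong: if_cong)
  also have "\<dots> \<le> s_val N U k"
    using k by (intro minor_norm_le_s_val) (auto simp: lessThan_empty_iff)
  finally show ?thesis using s_val_le_1[of k] k by simp
qed

end

section \<open>Majorization and entropies\<close>

text \<open>Summation by parts. The boundary term stays on the left because its sign has a different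
  reason in each application: a nonnegative least eigenvalue, or equal totals.\<close>

lemma abel_sum_ge:
  fixes d e :: "nat \<Rightarrow> real"
  assumes "\<And>i. i < n \<Longrightarrow> d (Suc i) \<le> d i"
    and "\<And>m. m \<le> Suc n \<Longrightarrow> 0 \<le> (\<Sum>k<m. e k)"
  shows "d n * (\<Sum>k<Suc n. e k) \<le> (\<Sum>k<Suc n. d k * e k)"
  using assms
proof (induction n)
  case 0
  then show ?case by simp
next
  case (Suc n)
  have "d (Suc n) * (\<Sum>k<Suc n. e k) \<le> d n * (\<Sum>k<Suc n. e k)"
    using Suc.prems(1)[of n] Suc.prems(2)[of "Suc n"] by (intro mult_right_mono) auto
  also have "\<dots> \<le> (\<Sum>k<Suc n. d k * e k)"
    using Suc.prems by (intro Suc.IH) auto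
  finally show ?case
    by (simp add: sum.lessThan_Suc[of _ "Suc n"] distrib_left del: sum.lessThan_Suc)
qed

text \<open>Adding the tangent inequalities from \<open>a\<close> to \<open>b\<close> and from
  \<open>b\<close> to \<open>a\<close> cancels the values of \<open>f\<close>, so convexity enters
  only through tangents and no derivative is taken.\<close>

lemma tangent_slope_mono:
  fixes f d :: "real \<Rightarrow> real"
  assumes tangent: "\<And>y z. 0 < y \<Longrightarrow> 0 \<le> z \<Longrightarrow> f y + d y * (z - y) \<le> f z"
    and "0 < a" "a \<le> b"
  shows "d a \<le> d b"
proof (cases "a = b")
  case False
  have "f a + d a * (b - a) \<le> f b" "f b + d b * (a - b) \<le> f a"
    using assms by (auto intro!: tangent)
  then have "0 \<le> (d b - d a) * (b - a)" by (simp add: algebra_simps)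
  then show ?thesis using False assms by (simp add: zero_le_mult_iff)
qed simp

text \<open>The majorizing sequence \<open>W\<close> need not be sorted: only the tangents at the points \<open>x c\<close> are
  used. Tangents are required at positive points only, since the entropy functions
  may have infinite slope at 0.\<close>

lemma sum_le_of_majorized:
  fixes x :: "'a \<Rightarrow> real" and W :: "nat \<Rightarrow> real" and f d :: "real \<Rightarrow> real"
  assumes J: "finite J" and x: "\<And>c. c \<in> J \<Longrightarrow> 0 \<le> x c"
    and W: "\<And>k. k \<in> {1..card J} \<Longrightarrow> 0 \<le> W k"
    and maj: "\<And>C. C \<subseteq> J \<Longrightarrow> (\<Sum>c\<in>C. x c) \<le> (\<Sum>k=1..card C. W k)"
    and total: "(\<Sum>c\<in>J. x c) = (\<Sum>k=1..card J. W k)"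
    and tangent: "\<And>y z. 0 < y \<Longrightarrow> 0 \<le> z \<Longrightarrow> f y + d y * (z - y) \<le> f z"
    and f0: "f 0 = 0"
  shows "(\<Sum>c\<in>J. f (x c)) \<le> (\<Sum>k=1..card J. f (W k))"
proof -
  obtain l where l: "set l = J" "distinct l" using finite_distinct_list[OF J] by blast
  define xs where "xs = sort_key (\<lambda>c. - x c) l"
  have xs: "set xs = J" "distinct xs" "sorted (map (\<lambda>c. - x c) xs)"
    using l by (simp_all add: xs_def)
  define n where "n = card J"
  have n: "length xs = n" using xs distinct_card by (metis n_def)
  define y where "y k = x (xs ! k)" for k
  have y0: "0 \<le> y k" if "k < n" for k
    using that xs n by (auto simp: y_def intro!: x)
  have y_anti: "y j \<le> y i" if "i \<le> j" "j < n" for i j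
    using sorted_nth_mono[OF xs(3), of i j] that n by (simp add: y_def)
  have sum_take: "(\<Sum>c\<in>set (take m xs). g c) = (\<Sum>k<m. g (xs ! k))"
    and card_take: "card (set (take m xs)) = m" if "m \<le> n" for m and g :: "'a \<Rightarrow> real"
  proof -
    have d: "distinct (take m xs)" using xs by simp
    show "card (set (take m xs)) = m" using distinct_card[OF d] that n by simp
    have "(\<Sum>c\<in>set (take m xs). g c) = sum_list (map g (take m xs))"
      using sum_list_distinct_conv_sum_set[OF d, of g] by simp
    also have "\<dots> = (\<Sum>k<m. g (xs ! k))"
      using that n by (simp add: sum_list_sum_nth lessThan_atLeast0)
    finally show "(\<Sum>c\<in>set (take m xs). g c) = (\<Sum>k<m. g (xs ! k))" .
  qed
  have sum_J: "(\<Sum>c\<in>J. g c) = (\<Sum>k<n. g (xs ! k))" for g :: "'a \<Rightarrow> real"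
    using sum_take[of n g] xs n by simp
  define V where "V k = W (Suc k)" for k
  have sum_W: "(\<Sum>k=1..m. g (W k)) = (\<Sum>k<m. g (V k))" for m and g :: "real \<Rightarrow> real"
    by (simp add: sum.atLeast1_atMost_eq V_def)
  have V0: "0 \<le> V k" if "k < n" for k
    using that unfolding V_def by (intro W) (simp add: n_def)
  have majV: "(\<Sum>k<m. y k) \<le> (\<Sum>k<m. V k)" if "m \<le> n" for m
    using maj[of "set (take m xs)"] sum_take[OF that, of x] card_take[OF that] sum_W[of "\<lambda>z. z" m]
      set_take_subset[of m xs] xs(1) by (simp add: y_def)
  have totV: "(\<Sum>k<n. y k) = (\<Sum>k<n. V k)"
    using total sum_J[of x] sum_W[of "\<lambda>z. z" n] by (simp add: n_def y_def)
  \<comment> \<open>The number of positive entries of \<open>y\<close>. Below \<open>K\<close>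
    tangents are available. Beyond it \<open>y\<close> vanishes, and then so does \<open>V\<close>:
    its first \<open>K\<close> entries already sum to at least the common total.\<close>
  define K where "K = (LEAST k. k = n \<or> y k = 0)"
  have K: "K = n \<or> y K = 0" unfolding K_def by (rule LeastI[of _ n]) simp
  have Kn: "K \<le> n" unfolding K_def by (rule Least_le) simp
  have ypos: "0 < y k" if "k < K" for k
    using that not_less_Least[of k "\<lambda>k. k = n \<or> y k = 0"] y0[of k] Kn unfolding K_def[symmetric]
    by (auto simp: less_le)
  have yz: "y k = 0" if "K \<le> k" "k < n" for k
    using K y_anti[OF that] y0[OF that(2)] that by auto
  have split: "(\<Sum>k<n. g k) = (\<Sum>k<K. g k) + (\<Sum>k=K..<n. g k)" for g :: "nat \<Rightarrow> real"
    using Kn by (simp add: lessThan_atLeast0 sum.atLeastLessThan_concat)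
  have yK: "(\<Sum>k<n. y k) = (\<Sum>k<K. y k)" using yz by (simp add: split)
  have V_tail0: "(\<Sum>k=K..<n. V k) \<ge> 0" using V0 by (intro sum_nonneg) auto
  then have V_tail: "(\<Sum>k=K..<n. V k) = 0" and totK: "(\<Sum>k<K. V k) = (\<Sum>k<K. y k)"
    using majV[OF Kn] totV yK split[of V] by linarith+
  have Vz: "V k = 0" if "K \<le> k" "k < n" for k
    using V_tail V0 that by (subst (asm) sum_nonneg_eq_0_iff) auto
  have "0 \<le> (\<Sum>k<K. d (y k) * (V k - y k))"
  proof (cases K)
    case (Suc m)
    have "d (y m) * (\<Sum>k<Suc m. V k - y k) \<le> (\<Sum>k<Suc m. d (y k) * (V k - y k))"
    proof (rule abel_sum_ge)
      show "d (y (Suc i)) \<le> d (y i)" if "i < m" for i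
        using that Suc Kn by (intro tangent_slope_mono[OF tangent] ypos y_anti) auto
      show "0 \<le> (\<Sum>k<j. V k - y k)" if "j \<le> Suc m" for j
        using majV[of j] that Suc Kn by (simp add: sum_subtractf)
    qed
    then show ?thesis using totK Suc by (simp add: sum_subtractf del: sum.lessThan_Suc)
  qed simp
  then have "(\<Sum>k<K. f (y k)) \<le> (\<Sum>k<K. f (y k) + d (y k) * (V k - y k))"
    by (simp add: sum.distrib)
  also have "\<dots> \<le> (\<Sum>k<K. f (V k))"
    using ypos V0 Kn by (intro sum_mono tangent) auto
  finally have "(\<Sum>k<n. f (y k)) \<le> (\<Sum>k<n. f (V k))"
    using yz Vz f0 by (simp add: split)
  then show ?thesis
    using sum_J[of "\<lambda>c. f (x c)"] sum_W[of f n] by (simp add: y_def n_def)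
qed

section \<open>Tangent inequalities for the entropy functions\<close>

lemma xlnx_tangent:
  fixes y z :: real
  assumes "0 < y" "0 \<le> z"
  shows "y * ln y + (ln y + 1) * (z - y) \<le> z * ln z"
proof (cases "z = 0")
  case False
  have "ln (y / z) \<le> y / z - 1" using assms False by (intro ln_le_minus_one) auto
  then have "z * (ln y - ln z) \<le> z * (y / z - 1)"
    using assms False by (simp add: ln_div)
  then show ?thesis using False by (simp add: algebra_simps)
qed (use assms in \<open>simp add: algebra_simps\<close>)

text \<open>The weighted mean inequality for the numbers \<open>t\<close> and 1 with weights
  \<open>a\<close> and \<open>1 - a\<close>: \<open>ln x \<le> x - 1\<close> is applied to both
  numbers divided by their mean \<open>M\<close>, and the weighted right sides cancel.\<close>

lemma powr_le_linear:
  fixes t a :: real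
  assumes "0 \<le> t" "0 \<le> a" "a < 1"
  shows "t powr a \<le> 1 + a * (t - 1)"
proof (cases "t = 0")
  case False
  define M where "M = 1 + a * (t - 1)"
  have "0 \<le> a * t" using assms by simp
  then have M: "M > 0" using assms(3) unfolding M_def right_diff_distrib by linarith
  have "ln (t / M) \<le> t / M - 1" "ln (1 / M) \<le> 1 / M - 1"
    using assms False M by (auto intro!: ln_le_minus_one)
  then have "a * ln (t / M) + (1 - a) * ln (1 / M) \<le> a * (t / M - 1) + (1 - a) * (1 / M - 1)"
    using assms by (intro add_mono mult_left_mono) auto
  also have "\<dots> = 0" using M by (simp add: field_simps) (simp add: M_def algebra_simps)
  finally have "a * ln t \<le> ln M"
    using assms False M by (simp add: ln_div algebra_simps)
  then have "exp (a * ln t) \<le> M" using M by (metis exp_le_cancel_iff exp_ln)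
  then show ?thesis using False by (simp add: powr_def M_def)
qed (use assms in simp)

text \<open>The case of small exponents, applied to \<open>t powr a\<close> with exponent
  \<open>1 / a\<close>.\<close>

lemma powr_ge_linear:
  fixes t a :: real
  assumes "0 \<le> t" "1 < a"
  shows "1 + a * (t - 1) \<le> t powr a"
proof -
  have "(t powr a) powr (1 / a) \<le> 1 + 1 / a * (t powr a - 1)"
    using assms by (intro powr_le_linear) auto
  then have "t \<le> 1 + (t powr a - 1) / a" using assms by (simp add: powr_powr)
  then have "(t - 1) * a \<le> t powr a - 1" using assms by (simp flip: pos_le_divide_eq)
  then show ?thesis by (simp add: mult.commute)
qed

text \<open>Homogeneity reduces the tangent at \<open>y\<close> to the tangent at 1 with
  \<open>t = z / y\<close>. The sign of \<open>1 - a\<close> changes exactly where powers turn from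
  concave to convex, so both ranges of \<open>a\<close> give a convex function.\<close>

lemma powr_tangent:
  fixes y z a :: real
  assumes y: "0 < y" and z: "0 \<le> z" and a: "0 \<le> a" "a \<noteq> 1"
  shows "- (y powr a / (1 - a)) + - (a * y powr (a - 1) / (1 - a)) * (z - y) \<le> - (z powr a / (1 - a))"
proof -
  have "z powr a = y powr a * (z / y) powr a"
    using y z by (simp flip: powr_mult)
  moreover have "y powr a * (1 + a * (z / y - 1)) = y powr a + a * y powr (a - 1) * (z - y)"
    using y by (simp add: powr_diff field_simps)
  ultimately have eq: "(y powr a + a * y powr (a - 1) * (z - y) - z powr a) / (1 - a)
      = y powr a * ((1 + a * (z / y - 1) - (z / y) powr a) / (1 - a))"
    by (simp add: algebra_simps)
  have "0 \<le> (1 + a * (z / y - 1) - (z / y) powr a) / (1 - a)"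
    using powr_le_linear[of "z / y" a] powr_ge_linear[of "z / y" a] y z a
    by (cases "a < 1") (auto simp: zero_le_divide_iff)
  then have "0 \<le> (y powr a + a * y powr (a - 1) * (z - y) - z powr a) / (1 - a)"
    unfolding eq by (intro mult_nonneg_nonneg) auto
  then show ?thesis by (simp add: add_divide_distrib diff_divide_distrib)
qed

lemma powr_ge_self:
  fixes x a :: real
  assumes "0 \<le> x" "x \<le> 1" "a \<le> 1"
  shows "x \<le> x powr a"
proof (cases "x = 0")
  case False
  then have "x powr 1 \<le> x powr a" using assms by (intro powr_mono') auto
  then show ?thesis using assms False by simp
qed simp

lemma entropy_bounds_of_majorization:
  fixes p q W :: "nat \<Rightarrow> real"
  assumes p: "\<And>i. i < N \<Longrightarrow> 0 \<le> p i" "(\<Sum>i<N. p i) = 1"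
    and q: "\<And>i. i < N \<Longrightarrow> 0 \<le> q i" "(\<Sum>i<N. q i) = 1"
    and W: "\<And>k. k \<in> {1..2*N} \<Longrightarrow> 0 \<le> W k" "(\<Sum>k=1..2*N. W k) = 2"
    and maj: "\<And>A B. A \<subseteq> {..<N} \<Longrightarrow> B \<subseteq> {..<N} \<Longrightarrow>
      (\<Sum>a\<in>A. p a) + (\<Sum>b\<in>B. q b) \<le> (\<Sum>k=1..card A + card B. W k)"
  shows "shannon {..<N} p + shannon {..<N} q \<ge> shannon {1..2*N} W
    \<and> (\<forall>\<alpha>. 0 \<le> \<alpha> \<longrightarrow> \<alpha> < 1 \<longrightarrow>
           renyi \<alpha> {..<N} p + renyi \<alpha> {..<N} q
             \<ge> 1 / (1 - \<alpha>) * ln ((\<Sum>i=1..2*N. W i powr \<alpha>) - 1))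
    \<and> (\<forall>\<alpha>. 0 \<le> \<alpha> \<longrightarrow> \<alpha> \<noteq> 1 \<longrightarrow>
           tsallis \<alpha> {..<N} p + tsallis \<alpha> {..<N} q
             \<ge> 1 / (1 - \<alpha>) * ((\<Sum>i=1..2*N. W i powr \<alpha>) - 2))"
proof -
  \<comment> \<open>The disjoint union makes \<open>p\<close> and \<open>q\<close> one family of
    \<open>2 * N\<close> numbers with total 2, to be compared with \<open>W\<close>.\<close>
  define J where "J = ({..<N} <+> {..<N} :: (nat + nat) set)"
  have J: "finite J" "card J = 2 * N" by (simp_all add: J_def card_Plus)
  have sumJ: "(\<Sum>c\<in>J. f (case_sum p q c)) = (\<Sum>i<N. f (p i)) + (\<Sum>i<N. f (q i))"
    for f :: "real \<Rightarrow> real"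
    by (simp add: J_def sum.Plus)
  have schur: "(\<Sum>i<N. f (p i)) + (\<Sum>i<N. f (q i)) \<le> (\<Sum>k=1..2*N. f (W k))"
    if "\<And>y z. 0 < y \<Longrightarrow> 0 \<le> z \<Longrightarrow> f y + d y * (z - y) \<le> f z" "f 0 = 0" for f d :: "real \<Rightarrow> real"
    unfolding sumJ[symmetric] J(2)[symmetric]
  proof (rule sum_le_of_majorized[where x = "case_sum p q" and f = f and d = d])
    show "0 \<le> case_sum p q c" if "c \<in> J" for c
      using that p q by (auto simp: J_def)
    show "0 \<le> W k" if "k \<in> {1..card J}" for k using that W J by simp
    show "(\<Sum>c\<in>J. case_sum p q c) = (\<Sum>k=1..card J. W k)"
      using sumJ[of "\<lambda>z. z"] p q W J by simp
    fix C assume C: "C \<subseteq> J"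
    define A B where "A = Inl -` C" and "B = Inr -` C"
    have C_eq: "C = A <+> B"
    proof (intro equalityI subsetI)
      fix c assume "c \<in> C" then show "c \<in> A <+> B" by (cases c) (auto simp: A_def B_def)
    qed (auto simp: A_def B_def)
    have AB: "A \<subseteq> {..<N}" "B \<subseteq> {..<N}" using C by (auto simp: A_def B_def J_def)
    have fin: "finite A" "finite B" using AB by (auto intro: finite_subset)
    show "(\<Sum>c\<in>C. case_sum p q c) \<le> (\<Sum>k=1..card C. W k)"
      using maj[OF AB] fin by (simp add: C_eq sum.Plus card_Plus)
  qed (use that J in auto)
  have powr_sum: "(\<Sum>i<N. p i powr a) / (1 - a) + (\<Sum>i<N. q i powr a) / (1 - a)
      \<ge> (\<Sum>k=1..2*N. W k powr a) / (1 - a)" if "0 \<le> a" "a \<noteq> 1" for a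
    using schur[OF powr_tangent[OF _ _ that]] by (simp add: sum_negf flip: sum_divide_distrib)
  have "(\<Sum>i<N. p i * ln (p i)) + (\<Sum>i<N. q i * ln (q i)) \<le> (\<Sum>k=1..2*N. W k * ln (W k))"
    by (rule schur[OF xlnx_tangent]) auto
  moreover have sh: "shannon I r = - (\<Sum>i\<in>I. r i * ln (r i))" for I r
    unfolding shannon_def by (intro arg_cong[of _ _ uminus] sum.cong) auto
  ultimately have 1: "shannon {..<N} p + shannon {..<N} q \<ge> shannon {1..2*N} W" by simp
  have 2: "renyi a {..<N} p + renyi a {..<N} q \<ge> 1 / (1 - a) * ln ((\<Sum>i=1..2*N. W i powr a) - 1)"
    if a: "0 \<le> a" "a < 1" for a
  proof -
    have ge1: "1 \<le> (\<Sum>i<N. r i powr a)" if r: "\<And>i. i < N \<Longrightarrow> 0 \<le> r i" "(\<Sum>i<N. r i) = 1" for r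
    proof -
      have "r i \<le> 1" if "i < N" for i
        using member_le_sum[of i "{..<N}" r] that r by auto
      then have "(\<Sum>i<N. r i) \<le> (\<Sum>i<N. r i powr a)"
        using r a by (intro sum_mono powr_ge_self) auto
      then show ?thesis using r by simp
    qed
    define P where "P = (\<Sum>i<N. p i powr a)"
    define Q where "Q = (\<Sum>i<N. q i powr a)"
    define R where "R = (\<Sum>i=1..2*N. W i powr a)"
    have PQ: "1 \<le> P" "1 \<le> Q" unfolding P_def Q_def using ge1 p q by auto
    have "R / (1 - a) \<le> (P + Q) / (1 - a)"
      using powr_sum[of a] a by (simp add: P_def Q_def R_def add_divide_distrib)
    then have "R \<le> P + Q" using a by (simp add: divide_le_cancel)
    moreover have "0 \<le> (P - 1) * (Q - 1)" using PQ by simp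
    ultimately have R: "R - 1 \<le> P * Q" by (simp add: algebra_simps)
    have "ln (R - 1) \<le> ln (P * Q)"
    proof (cases "R = 1")
      case True
      \<comment> \<open>The left side is \<open>ln 0\<close>, which has the value 0, so
        \<open>P * Q \<ge> 1\<close> is what this case requires.\<close>
      have "1 \<le> P * Q" using mult_mono[of 1 P 1 Q] PQ by simp
      then show ?thesis using True by simp
    next
      case False
      \<comment> \<open>Entries of \<open>W\<close> are bounded here only by the total 2. Halving
        makes them a probability vector, whose entries are at most their powers with exponent
        \<open>a < 1\<close>; this gives \<open>R \<ge> 1\<close>.\<close>
      have "W i / 2 \<le> (W i / 2) powr a" if i: "i \<in> {1..2*N}" for i
      proof (rule powr_ge_self)
        have "W i \<le> (\<Sum>k=1..2*N. W k)" using i W(1) by (intro member_le_sum) auto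
        then show "W i / 2 \<le> 1" using W by simp
      qed (use W(1)[OF i] a in auto)
      then have "(\<Sum>i=1..2*N. W i / 2) \<le> (\<Sum>i=1..2*N. (W i / 2) powr a)" by (intro sum_mono) auto
      also have "\<dots> \<le> (\<Sum>i=1..2*N. W i powr a)"
        using W(1) a by (intro sum_mono powr_mono2) auto
      finally have "R \<ge> 1" using W(2) by (simp add: R_def flip: sum_divide_distrib)
      then have "0 < R - 1" using False by simp
      then show ?thesis using R by (intro ln_mono) auto
    qed
    also have "\<dots> = ln P + ln Q" using PQ by (simp add: ln_mult)
    finally have "1 / (1 - a) * ln (R - 1) \<le> 1 / (1 - a) * (ln P + ln Q)"
      using a by (intro mult_left_mono) auto
    then show ?thesis by (simp add: renyi_def P_def Q_def R_def distrib_left)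
  qed
  have 3: "tsallis a {..<N} p + tsallis a {..<N} q \<ge> 1 / (1 - a) * ((\<Sum>i=1..2*N. W i powr a) - 2)"
    if "0 \<le> a" "a \<noteq> 1" for a
    using powr_sum[OF that] by (simp add: tsallis_def diff_divide_distrib)
  show ?thesis using 1 2 3 by blast
qed

section \<open>The majorizing vector\<close>

text \<open>The increments in \<open>m\<close> of the bound on the sum of the \<open>m\<close>
  largest eigenvalues of the Gram matrix. Up to the middle each adds a term
  \<open>s (k - j)\<close>; past the middle \<open>1 - s (j - 1)\<close> takes the last such term
  away again. For \<open>1 \<le> j \<le> k\<close> the value \<open>s 0\<close>, a maximum over the
  empty set, is never called.\<close>

definition eig_bound :: "(nat \<Rightarrow> real) \<Rightarrow> nat \<Rightarrow> nat \<Rightarrow> real" where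
  "eig_bound s k j =
    (if 2 * j \<le> k then 1 + s (k - j) else if 2 * j = k + 1 then 1 else 1 - s (j - 1))"

lemma sum_eig_bound:
  "m \<le> k \<Longrightarrow> (\<Sum>j=1..m. eig_bound s k j) = real m + (\<Sum>j=1..min m (k - m). s (k - j))"
proof (induction m)
  case (Suc m)
  have step: "(\<Sum>j=1..Suc m. eig_bound s k j) = (\<Sum>j=1..m. eig_bound s k j) + eig_bound s k (Suc m)"
    by simp
  have IH: "(\<Sum>j=1..m. eig_bound s k j) = real m + (\<Sum>j=1..min m (k - m). s (k - j))"
    using Suc by simp
  consider "2 * Suc m \<le> k" | "2 * Suc m = k + 1" | "2 * Suc m > k + 1" by linarith
  then show ?case
  proof cases
    case 1
    then have "min m (k - m) = m" "min (Suc m) (k - Suc m) = Suc m"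
      "eig_bound s k (Suc m) = 1 + s (k - Suc m)" by (auto simp: eig_bound_def)
    then show ?thesis unfolding step IH by simp
  next
    case 2
    then have "min m (k - m) = m" "min (Suc m) (k - Suc m) = m"
      "eig_bound s k (Suc m) = 1" by (auto simp: eig_bound_def)
    then show ?thesis unfolding step IH by simp
  next
    case 3
    define r where "r = k - Suc m"
    have "min m (k - m) = Suc r" "min (Suc m) (k - Suc m) = r" "k - Suc r = m"
      "eig_bound s k (Suc m) = 1 - s m"
      using 3 Suc.prems by (auto simp: r_def eig_bound_def)
    then show ?thesis unfolding step IH by simp
  qed
qed simp

text \<open>Removes the distinction by parity: the isolated summand for odd \<open>k\<close> has
  coefficient 1, the middle value fixed by the symmetry of the spectrum.\<close>

lemma S_val_eq: "S_val N U lam k = (\<Sum>j=1..k. lam_ext N lam j * eig_bound (s_val N U) k j)"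
proof -
  define n where "n = k div 2"
  consider "k = 0" | "k > 0" "k = n + n" | "k = n + Suc n" unfolding n_def by linarith
  then show ?thesis
  proof cases
    case 1
    then show ?thesis by (simp add: S_val_def)
  next
    case 2
    have "(\<Sum>j=1..k. lam_ext N lam j * eig_bound (s_val N U) k j) =
      (\<Sum>j=1..n. lam_ext N lam j * eig_bound (s_val N U) k j)
      + (\<Sum>j=n+1..k. lam_ext N lam j * eig_bound (s_val N U) k j)"
      unfolding 2(2) by (rule sum.ub_add_nat) simp
    also have "(\<Sum>j=1..n. lam_ext N lam j * eig_bound (s_val N U) k j)
        = (\<Sum>j=1..n. lam_ext N lam j * (1 + s_val N U (k - j)))"
      using 2 by (intro sum.cong) (auto simp: eig_bound_def)
    also have "(\<Sum>j=n+1..k. lam_ext N lam j * eig_bound (s_val N U) k j)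
        = (\<Sum>j=n+1..k. lam_ext N lam j * (1 - s_val N U (j - 1)))"
      using 2 by (intro sum.cong) (auto simp: eig_bound_def)
    finally show ?thesis using 2 by (simp add: S_val_def Let_def flip: n_def)
  next
    case 3
    have "(\<Sum>j=1..k. lam_ext N lam j * eig_bound (s_val N U) k j) =
      (\<Sum>j=1..n. lam_ext N lam j * eig_bound (s_val N U) k j)
      + (\<Sum>j=n+1..k. lam_ext N lam j * eig_bound (s_val N U) k j)"
      unfolding 3 by (rule sum.ub_add_nat) simp
    also have "(\<Sum>j=n+1..k. lam_ext N lam j * eig_bound (s_val N U) k j)
      = lam_ext N lam (n + 1) * eig_bound (s_val N U) k (n + 1)
        + (\<Sum>j=n+2..k. lam_ext N lam j * eig_bound (s_val N U) k j)"
      using 3 by (subst sum.atLeast_Suc_atMost) auto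
    also have "eig_bound (s_val N U) k (n + 1) = 1" using 3 by (simp add: eig_bound_def)
    also have "(\<Sum>j=1..n. lam_ext N lam j * eig_bound (s_val N U) k j)
        = (\<Sum>j=1..n. lam_ext N lam j * (1 + s_val N U (k - j)))"
      using 3 by (intro sum.cong) (auto simp: eig_bound_def)
    also have "(\<Sum>j=n+2..k. lam_ext N lam j * eig_bound (s_val N U) k j)
        = (\<Sum>j=n+2..k. lam_ext N lam j * (1 - s_val N U (j - 1)))"
      using 3 by (intro sum.cong) (auto simp: eig_bound_def)
    finally have "(\<Sum>j=1..k. lam_ext N lam j * eig_bound (s_val N U) k j) =
      (\<Sum>j=1..n. lam_ext N lam j * (1 + s_val N U (k - j))) + lam_ext N lam (n + 1)
      + (\<Sum>j=n+2..k. lam_ext N lam j * (1 - s_val N U (j - 1)))" by simp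
    moreover have "k \<noteq> 0" "odd k" using 3 by auto
    ultimately show ?thesis by (simp add: S_val_def Let_def flip: n_def)
  qed
qed

lemma sum_W_val: "(\<Sum>k=1..m. W_val N U lam k) = S_val N U lam m"
  by (induction m) (simp_all add: W_val_def S_val_def)

text \<open>Every coefficient grows from \<open>l = k - 1\<close> to \<open>k\<close>: below the
  middle because \<open>s\<close> is increasing, around it because the form changes from
  \<open>1 - s\<close> to 1 or from 1 to \<open>1 + s\<close>, and beyond it there is no change. The
  one new coefficient is nonnegative since \<open>s \<le> 1\<close>.\<close>

lemma W_val_nonneg:
  assumes U: "unitary_mat N U"
    and lam: "\<And>j. 1 \<le> j \<Longrightarrow> j \<le> N \<Longrightarrow> 0 \<le> lam j"
    and k: "k \<in> {1..2 * N}"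
  shows "0 \<le> W_val N U lam k"
proof -
  obtain l where l: "k = Suc l" using k by (cases k) auto
  define s where "s = s_val N U"
  have lam0: "0 \<le> lam_ext N lam j" if "1 \<le> j" for j
    using lam that by (simp add: lam_ext_def)
  have "eig_bound s l j \<le> eig_bound s k j" if j: "1 \<le> j" "j \<le> l" for j
  proof -
    consider "2 * j \<le> l" | "2 * j = k" | "2 * j = k + 1" | "2 * j > k + 1" using l by linarith
    then show ?thesis
    proof cases
      case 1
      have "s (l - j) \<le> s (Suc (l - j))"
        unfolding s_def using 1 j k l by (intro s_val_Suc_mono[OF U]) auto
      moreover have "Suc (l - j) = k - j" using 1 l by simp
      ultimately show ?thesis using 1 l by (simp add: eig_bound_def)
    next
      case 2
      have "0 \<le> s (k - j)" unfolding s_def using 2 j k l by (intro s_val_nonneg[OF U]) auto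
      then show ?thesis using 2 l by (simp add: eig_bound_def)
    next
      case 3
      have "0 \<le> s (j - 1)" unfolding s_def using 3 j k l by (intro s_val_nonneg[OF U]) auto
      then show ?thesis using 3 l by (simp add: eig_bound_def)
    next
      case 4
      then show ?thesis using l by (simp add: eig_bound_def)
    qed
  qed
  then have "(\<Sum>j=1..l. lam_ext N lam j * eig_bound s l j) \<le> (\<Sum>j=1..l. lam_ext N lam j * eig_bound s k j)"
    using lam0 by (intro sum_mono mult_left_mono) auto
  moreover have "0 \<le> eig_bound s k k"
  proof (cases "k = 1")
    case False
    have "s (k - 1) \<le> 1" unfolding s_def using False k l by (intro s_val_le_1[OF U]) auto
    then show ?thesis using False l by (simp add: eig_bound_def)
  qed (simp add: eig_bound_def)
  then have "0 \<le> lam_ext N lam k * eig_bound s k k" using lam0 l by simp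
  ultimately show ?thesis
    unfolding W_val_def S_val_eq s_def by (simp add: l)
qed

text \<open>The first \<open>N\<close> coefficients are \<open>1 + s (2 * N - j)\<close> with
  \<open>2 * N - j \<ge> N\<close>, where \<open>s\<close> equals 1; the remaining ones meet the
  zeros of \<open>lam_ext\<close>.\<close>

lemma S_val_total:
  assumes U: "unitary_mat N U"
  shows "S_val N U lam (2 * N) = 2 * (\<Sum>j=1..N. lam j)"
proof -
  have "S_val N U lam (2 * N) = (\<Sum>j=1..N. lam_ext N lam j * eig_bound (s_val N U) (2 * N) j)"
    unfolding S_val_eq by (rule sum.mono_neutral_right) (auto simp: lam_ext_def)
  also have "\<dots> = (\<Sum>j=1..N. 2 * lam j)"
    by (intro sum.cong) (auto simp: lam_ext_def eig_bound_def s_val_eq_1[OF U])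
  finally show ?thesis by (simp add: sum_distrib_left)
qed

text \<open>The diagonal blocks are identities, and the off-diagonal ones contribute twice the real
  part of \<open>F\<close>, controlled by the norm of the block of \<open>U\<close>. If
  \<open>A\<close> or \<open>B\<close> is empty there is no admissible block, but then
  \<open>F = 0\<close> and \<open>s \<ge> 0\<close> suffices.\<close>

lemma gram_form_le:
  fixes u :: "nat + nat \<Rightarrow> complex"
  assumes U: "unitary_mat N U" and AB: "A \<subseteq> {..<N}" "B \<subseteq> {..<N}" and card: "2 \<le> card A + card B"
    and GA: "\<And>a a'. a \<in> A \<Longrightarrow> a' \<in> A \<Longrightarrow> G (Inl a) (Inl a') = of_bool (a = a')"
    and GB: "\<And>b b'. b \<in> B \<Longrightarrow> b' \<in> B \<Longrightarrow> G (Inr b) (Inr b') = of_bool (b = b')"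
    and GU: "\<And>a b. a \<in> A \<Longrightarrow> b \<in> B \<Longrightarrow> G (Inl a) (Inr b) = U $$ (a, b)"
      "\<And>a b. a \<in> A \<Longrightarrow> b \<in> B \<Longrightarrow> G (Inr b) (Inl a) = cnj (U $$ (a, b))"
  shows "Re (\<Sum>c\<in>A <+> B. \<Sum>d\<in>A <+> B. cnj (u c) * G c d * u d)
    \<le> (1 + s_val N U (card A + card B - 1)) * (\<Sum>c\<in>A <+> B. (cmod (u c))\<^sup>2)"
proof -
  define s where "s = s_val N U (card A + card B - 1)"
  define F where "F = (\<Sum>a\<in>A. cnj (u (Inl a)) * (\<Sum>b\<in>B. U $$ (a, b) * u (Inr b)))"
  define nA nB where "nA = (\<Sum>a\<in>A. (cmod (u (Inl a)))\<^sup>2)" and "nB = (\<Sum>b\<in>B. (cmod (u (Inr b)))\<^sup>2)"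
  have fin: "finite A" "finite B" using AB by (auto intro: finite_subset)
  have cards: "card A \<le> N" "card B \<le> N" using AB by (metis card_lessThan card_mono finite_lessThan)+
  have s0: "0 \<le> s" unfolding s_def using card cards by (intro s_val_nonneg[OF U]) auto
  have n0: "0 \<le> nA" "0 \<le> nB" by (auto simp: nA_def nB_def sum_nonneg)
  have diag: "(\<Sum>c\<in>C. \<Sum>d\<in>C. cnj (w c) * of_bool (c = d) * w d) = of_real (\<Sum>c\<in>C. (cmod (w c))\<^sup>2)"
    if "finite C" for C :: "nat set" and w :: "nat \<Rightarrow> complex"
  proof -
    have "(\<Sum>c\<in>C. \<Sum>d\<in>C. cnj (w c) * of_bool (c = d) * w d)
        = (\<Sum>c\<in>C. \<Sum>d\<in>C. of_bool (c = d) * (w d * cnj (w c)))"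
      by (simp add: mult_ac)
    also have "\<dots> = (\<Sum>c\<in>C. w c * cnj (w c))"
      using that by (intro sum.cong refl) (simp only: sum_of_bool_mult)
    finally show ?thesis by (simp only: sum_mult_cnj)
  qed
  have "(\<Sum>c\<in>A <+> B. \<Sum>d\<in>A <+> B. cnj (u c) * G c d * u d) =
    (\<Sum>a\<in>A. (\<Sum>a'\<in>A. cnj (u (Inl a)) * G (Inl a) (Inl a') * u (Inl a'))
      + (\<Sum>b\<in>B. cnj (u (Inl a)) * G (Inl a) (Inr b) * u (Inr b)))
    + (\<Sum>b\<in>B. (\<Sum>a\<in>A. cnj (u (Inr b)) * G (Inr b) (Inl a) * u (Inl a))
      + (\<Sum>b'\<in>B. cnj (u (Inr b)) * G (Inr b) (Inr b') * u (Inr b')))"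
    using fin by (simp add: sum.Plus)
  also have "\<dots> =
    (\<Sum>a\<in>A. \<Sum>a'\<in>A. cnj (u (Inl a)) * of_bool (a = a') * u (Inl a'))
    + (\<Sum>a\<in>A. \<Sum>b\<in>B. cnj (u (Inl a)) * U $$ (a, b) * u (Inr b))
    + (\<Sum>b\<in>B. \<Sum>a\<in>A. cnj (u (Inr b)) * cnj (U $$ (a, b)) * u (Inl a))
    + (\<Sum>b\<in>B. \<Sum>b'\<in>B. cnj (u (Inr b)) * of_bool (b = b') * u (Inr b'))"
    by (simp add: sum.distrib GA GB GU)
  also have "(\<Sum>a\<in>A. \<Sum>b\<in>B. cnj (u (Inl a)) * U $$ (a, b) * u (Inr b)) = F"
    by (simp add: F_def sum_distrib_left mult_ac)
  also have "(\<Sum>b\<in>B. \<Sum>a\<in>A. cnj (u (Inr b)) * cnj (U $$ (a, b)) * u (Inl a)) = cnj F"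
    by (subst sum.swap) (simp add: F_def sum_distrib_left mult_ac)
  also have "(\<Sum>a\<in>A. \<Sum>a'\<in>A. cnj (u (Inl a)) * of_bool (a = a') * u (Inl a')) = of_real nA"
    unfolding nA_def by (rule diag[OF fin(1)])
  also have "(\<Sum>b\<in>B. \<Sum>b'\<in>B. cnj (u (Inr b)) * of_bool (b = b') * u (Inr b')) = of_real nB"
    unfolding nB_def by (rule diag[OF fin(2)])
  finally have form: "Re (\<Sum>c\<in>A <+> B. \<Sum>d\<in>A <+> B. cnj (u c) * G c d * u d) = nA + 2 * Re F + nB"
    by simp
  have "2 * Re F \<le> s * (nA + nB)"
  proof (cases "A = {} \<or> B = {}")
    case True
    then have "F = 0" by (auto simp: F_def)
    then show ?thesis using s0 n0 by simp
  next
    case False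
    have "2 * Re F \<le> minor_norm U A B * (nA + nB)"
      unfolding F_def nA_def nB_def by (rule minor_form_le[OF U AB])
    also have "\<dots> \<le> s * (nA + nB)"
      unfolding s_def using False AB card n0
      by (intro mult_right_mono minor_norm_le_s_val[OF U]) auto
    finally show ?thesis .
  qed
  moreover have "(\<Sum>c\<in>A <+> B. (cmod (u c))\<^sup>2) = nA + nB"
    using fin by (simp add: sum.Plus nA_def nB_def)
  ultimately show ?thesis unfolding form s_def[symmetric] by (simp add: algebra_simps)
qed

text \<open>\<open>X i a\<close> and \<open>Y i b\<close> are the coordinates of the \<open>a\<close>-th vector of the first and of the
  \<open>b\<close>-th vector of the second measurement basis in an eigenbasis of the state.\<close>

lemma sum_le_S_val:
  fixes X Y :: "nat \<Rightarrow> nat \<Rightarrow> complex" and lam :: "nat \<Rightarrow> real"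
  assumes U: "unitary_mat N U" and AB: "A \<subseteq> {..<N}" "B \<subseteq> {..<N}"
    and lam: "\<And>i j. 1 \<le> i \<Longrightarrow> i \<le> j \<Longrightarrow> j \<le> N \<Longrightarrow> lam j \<le> lam i"
      "\<And>j. 1 \<le> j \<Longrightarrow> j \<le> N \<Longrightarrow> 0 \<le> lam j"
    and X: "\<And>a a'. a < N \<Longrightarrow> a' < N \<Longrightarrow> (\<Sum>i<N. cnj (X i a) * X i a') = of_bool (a = a')"
    and Y: "\<And>b b'. b < N \<Longrightarrow> b' < N \<Longrightarrow> (\<Sum>i<N. cnj (Y i b) * Y i b') = of_bool (b = b')"
    and XY: "\<And>a b. a < N \<Longrightarrow> b < N \<Longrightarrow> (\<Sum>i<N. cnj (X i a) * Y i b) = U $$ (a, b)"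
  shows "(\<Sum>a\<in>A. \<Sum>i<N. lam (Suc i) * (cmod (X i a))\<^sup>2) + (\<Sum>b\<in>B. \<Sum>i<N. lam (Suc i) * (cmod (Y i b))\<^sup>2)
    \<le> S_val N U lam (card A + card B)"
proof (cases N)
  case 0
  then show ?thesis using AB by (simp add: S_val_def)
next
  case (Suc n)
  define J where "J = A <+> B"
  define k where "k = card A + card B"
  define v :: "nat + nat \<Rightarrow> nat \<Rightarrow> complex" where
    "v c i = (case c of Inl a \<Rightarrow> X i a | Inr b \<Rightarrow> Y i b)" for c i
  define G where "G c d = (\<Sum>i<N. cnj (v c i) * v d i)" for c d
  \<comment> \<open>Opposite signs on the two bases flip exactly the off-diagonal blocks of
    \<open>G\<close>, which sends \<open>G\<close> to \<open>2 - G\<close>.\<close>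
  define sg :: "nat + nat \<Rightarrow> complex" where "sg = case_sum (\<lambda>_. 1) (\<lambda>_. - 1)"
  define s where "s = s_val N U"
  \<comment> \<open>The diagonal, in the eigenbasis of the state, of the sum of the projections onto
    the vectors \<open>v c\<close>.\<close>
  define t where "t i = (\<Sum>c\<in>J. (cmod (v c i))\<^sup>2)" for i
  \<comment> \<open>Padded by 0 because \<open>m\<close> runs up to \<open>N\<close>, which may
    exceed \<open>k\<close>.\<close>
  define e where "e j = (if j \<le> k then eig_bound s k j else 0)" for j
  have fin: "finite A" "finite B" using AB by (auto intro: finite_subset)
  have J: "finite J" "card J = k" using fin by (simp_all add: J_def k_def card_Plus)
  have GX: "G (Inl a) (Inl a') = of_bool (a = a')" if "a < N" "a' < N" for a a'
    using X[OF that] by (simp add: G_def v_def)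
  have GY: "G (Inr b) (Inr b') = of_bool (b = b')" if "b < N" "b' < N" for b b'
    using Y[OF that] by (simp add: G_def v_def)
  have GXY: "G (Inl a) (Inr b) = U $$ (a, b)" if "a < N" "b < N" for a b
    using XY[OF that] by (simp add: G_def v_def)
  have GYX: "G (Inr b) (Inl a) = cnj (U $$ (a, b))" if "a < N" "b < N" for a b
    unfolding XY[OF that, symmetric] by (simp add: G_def v_def mult.commute)
  have top: "Re (\<Sum>c\<in>K. \<Sum>d\<in>K. cnj (u c) * G c d * u d) \<le> (1 + s (card K - 1)) * (\<Sum>c\<in>K. (cmod (u c))\<^sup>2)"
    if K: "K \<subseteq> J" "2 \<le> card K" for K u
  proof -
    define A' B' where "A' = Inl -` K" and "B' = Inr -` K"
    have K_eq: "K = A' <+> B'"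
    proof (intro equalityI subsetI)
      fix c assume "c \<in> K" then show "c \<in> A' <+> B'" by (cases c) (auto simp: A'_def B'_def)
    qed (auto simp: A'_def B'_def)
    have AB': "A' \<subseteq> {..<N}" "B' \<subseteq> {..<N}" using K(1) AB by (auto simp: A'_def B'_def J_def)
    then have "finite A'" "finite B'" by (auto intro: finite_subset)
    then have card: "card K = card A' + card B'" by (simp add: K_eq card_Plus)
    show ?thesis
      unfolding s_def card unfolding K_eq
      using K(2) AB' by (intro gram_form_le[OF U AB'] GX GY GXY GYX) (auto simp: card)
  qed
  have sg_G: "sg c * sg d * G c d = 2 * of_bool (c = d) - G c d" if "c \<in> J" "d \<in> J" for c d
    using that AB by (auto simp: J_def sg_def GX GY subset_eq)
  have sum_t: "(\<Sum>i<N. t i) = real k"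
  proof -
    have "complex_of_real (\<Sum>i<N. (cmod (v c i))\<^sup>2) = 1" if "c \<in> J" for c
    proof -
      have "complex_of_real (\<Sum>i<N. (cmod (v c i))\<^sup>2) = G c c"
        unfolding sum_mult_cnj[symmetric] G_def by (simp add: mult.commute)
      also have "\<dots> = 1" using that AB by (auto simp: J_def GX GY)
      finally show ?thesis .
    qed
    then have "(\<Sum>i<N. (cmod (v c i))\<^sup>2) = 1" if "c \<in> J" for c
      using that by (metis of_real_eq_1_iff)
    then show ?thesis unfolding t_def by (subst sum.swap) (simp add: J)
  qed
  have sum_e: "(\<Sum>i<m. e (Suc i)) = (\<Sum>j=1..min m k. eig_bound s k j)" for m
  proof -
    have "(\<Sum>i<m. e (Suc i)) = (\<Sum>j=1..m. e j)" by (simp add: sum.atLeast1_atMost_eq)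
    also have "\<dots> = (\<Sum>j=1..min m k. eig_bound s k j)"
      by (rule sum.mono_neutral_cong_right) (auto simp: e_def)
    finally show ?thesis .
  qed
  have partial: "(\<Sum>i<m. t i) \<le> (\<Sum>i<m. e (Suc i))" if m: "m \<le> N" for m
  proof (cases "m \<le> k")
    case True
    obtain T where T: "orth_proj J T" "trace_on J T = of_nat m"
      "(\<Sum>i<m. \<Sum>c\<in>J. (cmod (v c i))\<^sup>2) \<le> Re (\<Sum>c\<in>J. \<Sum>d\<in>J. G c d * T d c)"
      by (rule sum_sq_coords_le_gram_trace[OF J(1), of m N G v])
        (use True m J in \<open>auto simp: G_def intro: that\<close>)
    have "(\<Sum>i<m. t i) \<le> Re (\<Sum>c\<in>J. \<Sum>d\<in>J. G c d * T d c)" using T(3) by (simp add: t_def)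
    also have "\<dots> \<le> real m + (\<Sum>j=1..min m (card J - m). s (card J - j))"
      using True J by (intro gram_trace_le[OF J(1) top _ _ sg_G T(1,2)]) (auto simp: sg_def split: sum.split)
    also have "\<dots> = (\<Sum>i<m. e (Suc i))"
      using True by (simp only: sum_e J(2) sum_eig_bound min_absorb1)
    finally show ?thesis .
  next
    case False
    \<comment> \<open>All \<open>t i\<close> together sum to \<open>k\<close>, a value the bounds
      have already reached after \<open>k\<close> terms.\<close>
    have "(\<Sum>i<m. t i) \<le> (\<Sum>i<N. t i)"
      using m by (intro sum_mono2) (auto simp: t_def sum_nonneg)
    also have "\<dots> = (\<Sum>i<m. e (Suc i))"
      using False sum_eig_bound[of k k s] by (simp add: sum_t sum_e)
    finally show ?thesis .
  qed
  \<comment> \<open>The boundary term of the Abel summation; since \<open>N = Suc n\<close>, its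
    coefficient is the least eigenvalue.\<close>
  have "0 \<le> lam (Suc n) * (\<Sum>i<Suc n. e (Suc i) - t i)"
    using partial[of N] lam(2)[of N] Suc by (intro mult_nonneg_nonneg) (simp_all add: sum_subtractf)
  also have "\<dots> \<le> (\<Sum>i<Suc n. lam (Suc i) * (e (Suc i) - t i))"
    using partial Suc by (intro abel_sum_ge lam) (auto simp: sum_subtractf)
  finally have "(\<Sum>i<N. lam (Suc i) * t i) \<le> (\<Sum>i<N. lam (Suc i) * e (Suc i))"
    unfolding Suc[symmetric] by (simp add: right_diff_distrib sum_subtractf)
  also have "\<dots> = (\<Sum>j=1..N. lam j * e j)"
    by (simp add: sum.atLeast1_atMost_eq)
  also have "\<dots> = (\<Sum>j=1..min N k. lam j * eig_bound s k j)"
    by (rule sum.mono_neutral_cong_right) (auto simp: e_def)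
  also have "\<dots> = (\<Sum>j=1..k. lam_ext N lam j * eig_bound s k j)"
    by (rule sum.mono_neutral_cong_left) (auto simp: lam_ext_def)
  also have "\<dots> = S_val N U lam k" by (simp add: S_val_eq s_def)
  finally have "(\<Sum>i<N. lam (Suc i) * t i) \<le> S_val N U lam k" .
  moreover have "(\<Sum>i<N. lam (Suc i) * t i) =
      (\<Sum>a\<in>A. \<Sum>i<N. lam (Suc i) * (cmod (X i a))\<^sup>2) + (\<Sum>b\<in>B. \<Sum>i<N. lam (Suc i) * (cmod (Y i b))\<^sup>2)"
    using fin by (simp add: t_def J_def sum.Plus v_def distrib_left sum.distrib sum_distrib_left sum.swap[of _ _ "{..<N}"])
  ultimately show ?thesis by (simp add: k_def)
qed

section \<open>Eigenbasis of a hermitian matrix\<close>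

definition inner_on :: "nat \<Rightarrow> (nat \<Rightarrow> complex) \<Rightarrow> (nat \<Rightarrow> complex) \<Rightarrow> complex" where
  "inner_on N x y = (\<Sum>a<N. cnj (x a) * y a)"

lemma inner_on_commute: "inner_on N y x = cnj (inner_on N x y)"
  by (simp add: inner_on_def mult.commute)

lemma inner_on_lincomb:
  "inner_on N x (\<lambda>a. \<Sum>i\<in>I. c i * y i a) = (\<Sum>i\<in>I. c i * inner_on N x (y i))"
  unfolding inner_on_def sum_distrib_left by (subst sum.swap) (simp add: mult_ac)

lemma inner_on_diff: "inner_on N x (\<lambda>a. y a - z a) = inner_on N x y - inner_on N x z"
  by (simp add: inner_on_def right_diff_distrib sum_subtractf)

lemma inner_on_scale: "inner_on N x (\<lambda>a. c * y a) = c * inner_on N x y"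
  by (simp add: inner_on_def sum_distrib_left mult_ac)

lemma inner_on_cong:
  "(\<And>a. a < N \<Longrightarrow> x a = x' a) \<Longrightarrow> (\<And>a. a < N \<Longrightarrow> y a = y' a) \<Longrightarrow> inner_on N x y = inner_on N x' y'"
  by (simp add: inner_on_def)

text \<open>Gram-Schmidt on the columns of a triangularising matrix \<open>P\<close> of a hermitian matrix yields
  eigenvectors. That no step degenerates is witnessed by the rows of the inverse \<open>Q\<close>: row \<open>l\<close>
  annihilates all vectors built from the first \<open>l\<close> columns but not column \<open>l\<close>.\<close>

lemma hermitian_triangular_eigenvectors:
  fixes R P Q B :: "nat \<Rightarrow> nat \<Rightarrow> complex" and mu :: "nat \<Rightarrow> real"
  assumes herm: "\<And>a b. a < N \<Longrightarrow> b < N \<Longrightarrow> cnj (R a b) = R b a"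
    and RP: "\<And>a j. a < N \<Longrightarrow> j < N \<Longrightarrow>
      (\<Sum>b<N. R a b * P j b) = of_real (mu j) * P j a + (\<Sum>i<j. B i j * P i a)"
    and QP: "\<And>l j. l < N \<Longrightarrow> j < N \<Longrightarrow> (\<Sum>a<N. Q l a * P j a) = of_bool (l = j)"
    and "m \<le> N"
  shows "\<exists>w. (\<forall>i<m. \<forall>j<m. inner_on N (w i) (w j) = of_bool (i = j)) \<and>
    (\<forall>j<m. \<forall>a<N. (\<Sum>b<N. R a b * w j b) = of_real (mu j) * w j a) \<and>
    (\<forall>j<m. \<forall>a<N. P j a = (\<Sum>i<m. inner_on N (w i) (P j) * w i a)) \<and>
    (\<forall>j<m. \<forall>l. m \<le> l \<longrightarrow> l < N \<longrightarrow> (\<Sum>a<N. Q l a * w j a) = 0)"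
  using \<open>m \<le> N\<close>
proof (induction m)
  case 0
  show ?case by simp
next
  case (Suc m)
  obtain w where w: "(\<forall>i<m. \<forall>j<m. inner_on N (w i) (w j) = of_bool (i = j)) \<and>
    (\<forall>j<m. \<forall>a<N. (\<Sum>b<N. R a b * w j b) = of_real (mu j) * w j a) \<and>
    (\<forall>j<m. \<forall>a<N. P j a = (\<Sum>i<m. inner_on N (w i) (P j) * w i a)) \<and>
    (\<forall>j<m. \<forall>l. m \<le> l \<longrightarrow> l < N \<longrightarrow> (\<Sum>a<N. Q l a * w j a) = 0)"
    by (rule exE[OF Suc.IH[OF Suc_leD[OF Suc.prems]]]) (rule that)
  then have
    orth: "\<And>i j. i < m \<Longrightarrow> j < m \<Longrightarrow> inner_on N (w i) (w j) = of_bool (i = j)" and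
    eig: "\<And>j a. j < m \<Longrightarrow> a < N \<Longrightarrow> (\<Sum>b<N. R a b * w j b) = of_real (mu j) * w j a" and
    exp_P: "\<And>j a. j < m \<Longrightarrow> a < N \<Longrightarrow> P j a = (\<Sum>i<m. inner_on N (w i) (P j) * w i a)" and
    ann: "\<And>j l. j < m \<Longrightarrow> m \<le> l \<Longrightarrow> l < N \<Longrightarrow> (\<Sum>a<N. Q l a * w j a) = 0"
    by blast+
  have m: "m < N" using Suc.prems by simp
  define al where "al i = inner_on N (w i) (P m)" for i
  define v where "v a = P m a - (\<Sum>i<m. al i * w i a)" for a
  have wv: "inner_on N (w i) v = 0" if i: "i < m" for i
  proof -
    have "inner_on N (w i) v = al i - (\<Sum>j<m. al j * of_bool (i = j))"
      unfolding v_def inner_on_diff inner_on_lincomb using i by (simp add: orth al_def)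
    then show ?thesis using i by (simp add: sum_of_bool_mult)
  qed
  have Qv: "(\<Sum>a<N. Q l a * v a) = of_bool (l = m)" if l: "m \<le> l" "l < N" for l
  proof -
    have "(\<Sum>a<N. Q l a * (\<Sum>i<m. al i * w i a)) = (\<Sum>i<m. al i * (\<Sum>a<N. Q l a * w i a))"
      unfolding sum_distrib_left by (subst sum.swap) (simp add: mult_ac)
    also have "\<dots> = 0" using ann l by simp
    finally show ?thesis
      unfolding v_def right_diff_distrib sum_subtractf using QP[OF l(2) m] by simp
  qed
  define n where "n = sqrt (\<Sum>a<N. (cmod (v a))\<^sup>2)"
  have "\<exists>a<N. v a \<noteq> 0"
  proof (rule ccontr)
    assume "\<not> ?thesis"
    then have "(\<Sum>a<N. Q m a * v a) = 0" by simp
    then show False using Qv[of m] m by simp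
  qed
  then obtain a0 where "a0 < N" "v a0 \<noteq> 0" by blast
  then have "(\<Sum>a<N. (cmod (v a))\<^sup>2) > 0" by (intro sum_pos2[of _ a0]) auto
  then have n: "n > 0" and n2: "n\<^sup>2 = (\<Sum>a<N. (cmod (v a))\<^sup>2)" by (auto simp: n_def)
  have vv: "inner_on N v v = of_real (n\<^sup>2)"
    unfolding n2 sum_mult_cnj[symmetric] by (simp add: inner_on_def mult.commute)
  have Rv: "(\<Sum>b<N. R a b * v b) = of_real (mu m) * v a" if a: "a < N" for a
  proof -
    define z where "z a = (\<Sum>b<N. R a b * v b) - of_real (mu m) * v a" for a
    \<comment> \<open>The coefficients of the residual \<open>R v - mu m v\<close> in the earlier
      eigenvectors. Triangularity puts the residual into their span, while hermiticity together with
      \<open>wv\<close> makes it orthogonal to them, so it is 0; repeated eigenvalues cause no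
      exception.\<close>
    define be where "be i = (\<Sum>l<m. B l m * inner_on N (w i) (P l)) - al i * (of_real (mu i) - of_real (mu m))" for i
    have z_span: "z a = (\<Sum>i<m. be i * w i a)" if a: "a < N" for a
    proof -
      have "(\<Sum>b<N. R a b * v b) = (\<Sum>b<N. R a b * P m b) - (\<Sum>b<N. R a b * (\<Sum>i<m. al i * w i b))"
        by (simp add: v_def right_diff_distrib sum_subtractf)
      also have "(\<Sum>b<N. R a b * (\<Sum>i<m. al i * w i b)) = (\<Sum>i<m. al i * (\<Sum>b<N. R a b * w i b))"
        unfolding sum_distrib_left by (subst sum.swap) (simp add: mult_ac)
      also have "\<dots> = (\<Sum>i<m. al i * of_real (mu i) * w i a)"
        using a by (simp add: eig mult_ac)
      also have "(\<Sum>b<N. R a b * P m b) = of_real (mu m) * P m a + (\<Sum>l<m. B l m * (\<Sum>i<m. inner_on N (w i) (P l) * w i a))"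
        unfolding RP[OF a m] using a exp_P by simp
      also have "(\<Sum>l<m. B l m * (\<Sum>i<m. inner_on N (w i) (P l) * w i a))
          = (\<Sum>i<m. (\<Sum>l<m. B l m * inner_on N (w i) (P l)) * w i a)"
        unfolding sum_distrib_left sum_distrib_right by (subst sum.swap) (simp add: mult_ac)
      finally show ?thesis
        by (simp add: z_def be_def v_def algebra_simps sum.distrib sum_subtractf sum_distrib_left)
    qed
    have wz: "inner_on N (w i) z = 0" if i: "i < m" for i
    proof -
      have "inner_on N (w i) (\<lambda>a. \<Sum>b<N. R a b * v b) = (\<Sum>a<N. \<Sum>b<N. cnj (w i a) * R a b * v b)"
        by (simp add: inner_on_def sum_distrib_left mult_ac)
      also have "\<dots> = (\<Sum>b<N. \<Sum>a<N. cnj (w i a) * R a b * v b)"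
        by (rule sum.swap)
      also have "\<dots> = (\<Sum>b<N. cnj (\<Sum>a<N. R b a * w i a) * v b)"
        unfolding cnj_sum sum_distrib_right
        by (intro sum.cong refl) (simp add: herm mult_ac)
      also have "\<dots> = (\<Sum>b<N. of_real (mu i) * (cnj (w i b) * v b))"
        using i by (intro sum.cong refl) (simp add: eig)
      also have "\<dots> = 0"
        using wv[OF i] by (simp add: inner_on_def flip: sum_distrib_left)
      finally have "inner_on N (w i) (\<lambda>a. \<Sum>b<N. R a b * v b) = 0" .
      then show ?thesis unfolding z_def inner_on_diff inner_on_scale wv[OF i] by simp
    qed
    have "be i = 0" if i: "i < m" for i
    proof -
      have "inner_on N (w i) z = inner_on N (w i) (\<lambda>a. \<Sum>j<m. be j * w j a)"
        by (rule inner_on_cong) (simp_all add: z_span)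
      also have "\<dots> = (\<Sum>j<m. be j * of_bool (i = j))"
        unfolding inner_on_lincomb using i by (simp add: orth)
      also have "\<dots> = be i" using i by (simp add: sum_of_bool_mult)
      finally show ?thesis using wz[OF i] by simp
    qed
    then have "z a = 0" using z_span[OF a] by simp
    then show ?thesis by (simp add: z_def)
  qed
  define w' where "w' = w(m := (\<lambda>a. of_real (1 / n) * v a))"
  have w'_lt: "w' i = w i" if "i < m" for i using that by (simp add: w'_def)
  have w'_m: "w' m = (\<lambda>a. of_real (1 / n) * v a)" by (simp add: w'_def)
  have scale_left: "inner_on N (\<lambda>a. of_real (1 / n) * v a) y = of_real (1 / n) * inner_on N v y" for y
    by (simp add: inner_on_def sum_distrib_left)
  have vw: "inner_on N v (w i) = 0" if "i < m" for i
    using wv[OF that] inner_on_commute[of N v "w i"] by simp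
  have vPm: "inner_on N v (P m) = of_real (n\<^sup>2)"
  proof -
    have "inner_on N v v = inner_on N v (P m) - (\<Sum>i<m. al i * inner_on N v (w i))"
      unfolding v_def[of "_"] inner_on_diff inner_on_lincomb by (simp add: v_def)
    then show ?thesis using vw vv by simp
  qed
  have vP: "inner_on N v (P j) = 0" if j: "j < m" for j
  proof -
    have "inner_on N v (P j) = inner_on N v (\<lambda>a. \<Sum>i<m. inner_on N (w i) (P j) * w i a)"
      by (rule inner_on_cong) (use exp_P j in auto)
    then show ?thesis unfolding inner_on_lincomb by (simp add: vw)
  qed
  show ?case
  proof (intro exI[of _ w'] conjI allI impI)
    fix i j assume ij: "i < Suc m" "j < Suc m"
    have "inner_on N (w' m) (w' m) = 1"
      unfolding w'_m scale_left inner_on_scale vv using n by (simp add: power2_eq_square)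
    moreover have "inner_on N (w' m) (w' i) = 0" "inner_on N (w' i) (w' m) = 0" if "i < m" for i
      unfolding w'_m w'_lt[OF that] scale_left inner_on_scale using wv[OF that] vw[OF that] by simp_all
    ultimately show "inner_on N (w' i) (w' j) = of_bool (i = j)"
      using ij by (auto simp: less_Suc_eq w'_lt orth)
  next
    fix j a assume j: "j < Suc m" and a: "a < N"
    have "(\<Sum>b<N. R a b * w' m b) = of_real (1 / n) * (\<Sum>b<N. R a b * v b)"
      by (simp add: w'_m sum_distrib_left mult_ac)
    then have "(\<Sum>b<N. R a b * w' m b) = of_real (mu m) * w' m a"
      by (simp add: Rv[OF a] w'_m)
    then show "(\<Sum>b<N. R a b * w' j b) = of_real (mu j) * w' j a"
      using j a by (auto simp: less_Suc_eq w'_lt eig)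
    have "P j a = (\<Sum>i<m. inner_on N (w i) (P j) * w i a) + inner_on N (w' m) (P j) * w' m a"
    proof (cases "j = m")
      case True
      have "inner_on N (w' m) (P m) * w' m a = v a"
        unfolding w'_m scale_left vPm using n by (simp add: power2_eq_square)
      then show ?thesis using True by (simp add: v_def al_def)
    next
      case False
      then have "j < m" using j by simp
      then show ?thesis
        using exp_P[OF _ a] vP unfolding w'_m scale_left by simp
    qed
    then show "P j a = (\<Sum>i<Suc m. inner_on N (w' i) (P j) * w' i a)"
      by (simp add: w'_lt)
  next
    fix j l assume jl: "j < Suc m" "Suc m \<le> l" "l < N"
    have "(\<Sum>a<N. Q l a * w' m a) = of_real (1 / n) * (\<Sum>a<N. Q l a * v a)"
      by (simp add: w'_m sum_distrib_left mult_ac)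
    then have "(\<Sum>a<N. Q l a * w' m a) = 0" using Qv[of l] jl by simp
    then show "(\<Sum>a<N. Q l a * w' j a) = 0"
      using jl by (auto simp: less_Suc_eq w'_lt ann)
  qed
qed

text \<open>The triangular form carries the prescribed list \<open>es\<close> on its diagonal, so
  the eigenvectors come in the order of \<open>lam\<close> with multiplicities. Only similarity is
  taken from it; orthonormality is supplied by the Gram-Schmidt argument.\<close>

lemma hermitian_eigenbasis:
  fixes A :: "complex mat" and lam :: "nat \<Rightarrow> real"
  assumes A: "A \<in> carrier_mat N N" "mat_adjoint A = A"
    and cp: "char_poly A = (\<Prod>j=1..N. [:- complex_of_real (lam j), 1:])"
  obtains w where "\<And>i j. i < N \<Longrightarrow> j < N \<Longrightarrow> inner_on N (w i) (w j) = of_bool (i = j)"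
    "\<And>j a. j < N \<Longrightarrow> a < N \<Longrightarrow> (\<Sum>b<N. A $$ (a, b) * w j b) = of_real (lam (Suc j)) * w j a"
proof -
  define es where "es = map (\<lambda>j. complex_of_real (lam (Suc j))) [0..<N]"
  have "char_poly A = (\<Prod>e\<leftarrow>es. [:- e, 1:])"
    unfolding cp es_def
    by (simp add: prod.atLeast1_atMost_eq o_def interv_sum_list_conv_sum_set_nat
        prod.distinct_set_conv_list[symmetric] lessThan_atLeast0)
  then obtain B P Q where BPQ: "similar_mat_wit A B P Q" "upper_triangular B" "diag_mat B = es"
    using schur_decomposition[OF A(1)] by (metis prod_cases3)
  note sim = similar_mat_witD2[OF A(1) BPQ(1)]
  have dims: "B \<in> carrier_mat N N" "P \<in> carrier_mat N N" "Q \<in> carrier_mat N N" using sim by auto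
  have "A * P = P * B * (Q * P)" using sim dims by (simp add: assoc_mult_mat[of _ N N _ N _ N])
  then have AP: "A * P = P * B" using sim dims by simp
  have diag: "B $$ (j, j) = of_real (lam (Suc j))" if "j < N" for j
  proof -
    have "diag_mat B ! j = B $$ (j, j)" using that dims by (simp add: diag_mat_def)
    then show ?thesis using that by (simp add: BPQ(3) es_def)
  qed
  have 1: "cnj (A $$ (a, b)) = A $$ (b, a)" if "a < N" "b < N" for a b
    using mat_adjoint_index[of b A a] that A by simp
  have 2: "(\<Sum>b<N. A $$ (a, b) * P $$ (b, j)) =
      of_real (lam (Suc j)) * P $$ (a, j) + (\<Sum>i<j. B $$ (i, j) * P $$ (a, i))"
    if aj: "a < N" "j < N" for a j
  proof -
    have "(\<Sum>b<N. A $$ (a, b) * P $$ (b, j)) = (A * P) $$ (a, j)"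
      by (rule mat_mult_index_sum[symmetric]) (use A dims aj in auto)
    also have "\<dots> = (\<Sum>i<N. P $$ (a, i) * B $$ (i, j))"
      unfolding AP by (rule mat_mult_index_sum) (use dims aj in auto)
    also have "\<dots> = (\<Sum>i<Suc j. P $$ (a, i) * B $$ (i, j))"
      using aj dims BPQ(2) by (intro sum.mono_neutral_right) (auto simp: upper_triangular_def)
    finally show ?thesis using diag[OF aj(2)] by (simp add: mult.commute)
  qed
  have 3: "(\<Sum>a<N. Q $$ (l, a) * P $$ (a, j)) = of_bool (l = j)" if "l < N" "j < N" for l j
  proof -
    have "(\<Sum>a<N. Q $$ (l, a) * P $$ (a, j)) = (Q * P) $$ (l, j)"
      by (rule mat_mult_index_sum[symmetric]) (use dims that in auto)
    then show ?thesis using sim that by simp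
  qed
  have "\<exists>w. (\<forall>i<N. \<forall>j<N. inner_on N (w i) (w j) = of_bool (i = j)) \<and>
    (\<forall>j<N. \<forall>a<N. (\<Sum>b<N. A $$ (a, b) * w j b) = of_real (lam (Suc j)) * w j a) \<and>
    (\<forall>j<N. \<forall>a<N. P $$ (a, j) = (\<Sum>i<N. inner_on N (w i) (\<lambda>a. P $$ (a, j)) * w i a)) \<and>
    (\<forall>j<N. \<forall>l. N \<le> l \<longrightarrow> l < N \<longrightarrow> (\<Sum>a<N. Q $$ (l, a) * w j a) = 0)"
    by (rule hermitian_triangular_eigenvectors[where R = "\<lambda>a b. A $$ (a, b)" and P = "\<lambda>j a. P $$ (a, j)"
        and mu = "\<lambda>j. lam (Suc j)" and B = "\<lambda>i j. B $$ (i, j)" and Q = "\<lambda>l a. Q $$ (l, a)",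
        OF 1 2 3 order_refl])
  then obtain w where "\<forall>i<N. \<forall>j<N. inner_on N (w i) (w j) = of_bool (i = j)"
    "\<forall>j<N. \<forall>a<N. (\<Sum>b<N. A $$ (a, b) * w j b) = of_real (lam (Suc j)) * w j a"
    by (elim exE conjE) (rule that)
  then show thesis by (intro that[of w]) simp_all
qed

text \<open>A left inverse of a square matrix is a right inverse. This is used for the eigenbasis
  and to pass from the columns of \<open>U\<close> to its rows.\<close>

lemma orthonormal_complete:
  assumes orth: "\<And>i j. i < N \<Longrightarrow> j < N \<Longrightarrow> inner_on N (w i) (w j) = of_bool (i = j)"
    and ab: "a < N" "b < N"
  shows "(\<Sum>j<N. w j a * cnj (w j b)) = of_bool (a = b)"
proof -
  define W where "W = mat N N (\<lambda>(a, j). w j a)"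
  define V where "V = mat N N (\<lambda>(j, a). cnj (w j a))"
  have dims: "W \<in> carrier_mat N N" "V \<in> carrier_mat N N" by (simp_all add: W_def V_def)
  have "V * W = 1\<^sub>m N"
  proof (rule eq_matI)
    fix i j assume "i < dim_row (1\<^sub>m N :: complex mat)" "j < dim_col (1\<^sub>m N :: complex mat)"
    then have ij: "i < N" "j < N" by simp_all
    have "(V * W) $$ (i, j) = (\<Sum>a<N. V $$ (i, a) * W $$ (a, j))"
      by (rule mat_mult_index_sum) (use dims ij in auto)
    also have "\<dots> = inner_on N (w i) (w j)" using ij by (simp add: W_def V_def inner_on_def)
    finally show "(V * W) $$ (i, j) = 1\<^sub>m N $$ (i, j)" using orth[OF ij] ij by simp
  qed (use dims in auto)
  then have "W * V = 1\<^sub>m N" by (rule mat_mult_left_right_inverse[OF dims(2,1)])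
  then have "1\<^sub>m N $$ (a, b) = (\<Sum>j<N. W $$ (a, j) * V $$ (j, b))"
    using mat_mult_index_sum[OF dims ab] by simp
  also have "\<dots> = (\<Sum>j<N. w j a * cnj (w j b))" using ab by (simp add: W_def V_def)
  finally have "(\<Sum>j<N. w j a * cnj (w j b)) = 1\<^sub>m N $$ (a, b)" by (rule sym)
  then show ?thesis using ab by simp
qed

section \<open>Entropic uncertainty relations\<close>

theorem theorem2:
  fixes N :: nat and U \<rho> :: "complex mat" and lam :: "nat \<Rightarrow> real"
    and p q :: "nat \<Rightarrow> real"
  assumes "N \<ge> 1"
    and "unitary_mat N U"
    and "density_mat N \<rho>"
    and "\<And>i j. 1 \<le> i \<Longrightarrow> i \<le> j \<Longrightarrow> j \<le> N \<Longrightarrow> lam j \<le> lam i"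
    and "char_poly \<rho> = (\<Prod>j=1..N. [:- complex_of_real (lam j), 1:])"
    and "\<And>i. i < N \<Longrightarrow> p i = Re (\<rho> $$ (i, i))"
    and "\<And>i. i < N \<Longrightarrow> q i = Re ((mat_adjoint U * \<rho> * U) $$ (i, i))"
  shows "shannon {..<N} p + shannon {..<N} q \<ge> shannon {1..2*N} (W_val N U lam)
    \<and> (\<forall>\<alpha>. 0 \<le> \<alpha> \<longrightarrow> \<alpha> < 1 \<longrightarrow>
           renyi \<alpha> {..<N} p + renyi \<alpha> {..<N} q
             \<ge> 1 / (1 - \<alpha>) * ln ((\<Sum>i=1..2*N. W_val N U lam i powr \<alpha>) - 1))
    \<and> (\<forall>\<alpha>. 0 \<le> \<alpha> \<longrightarrow> \<alpha> \<noteq> 1 \<longrightarrow>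
           tsallis \<alpha> {..<N} p + tsallis \<alpha> {..<N} q
             \<ge> 1 / (1 - \<alpha>) * ((\<Sum>i=1..2*N. W_val N U lam i powr \<alpha>) - 2))"
proof -
  note U = assms(2) and lam_mono = assms(4)
  have Ud: "U \<in> carrier_mat N N" using U by (simp add: unitary_mat_def)
  have \<rho>: "\<rho> \<in> carrier_mat N N" "mat_adjoint \<rho> = \<rho>" "(\<Sum>i<N. \<rho> $$ (i, i)) = 1"
    and \<rho>_pos: "\<And>v. v \<in> carrier_vec N \<Longrightarrow> 0 \<le> Re (cscalar_prod (\<rho> *\<^sub>v v) v)"
    using assms(3) by (auto simp: density_mat_def)
  obtain w where orth: "\<And>i j. i < N \<Longrightarrow> j < N \<Longrightarrow> inner_on N (w i) (w j) = of_bool (i = j)"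
    and eig: "\<And>j a. j < N \<Longrightarrow> a < N \<Longrightarrow> (\<Sum>b<N. \<rho> $$ (a, b) * w j b) = of_real (lam (Suc j)) * w j a"
    by (rule hermitian_eigenbasis[OF \<rho>(1,2) assms(5)]) (rule that)
  have norm_w: "(\<Sum>a<N. (cmod (w j a))\<^sup>2) = 1" if "j < N" for j
  proof -
    have "complex_of_real (\<Sum>a<N. (cmod (w j a))\<^sup>2) = inner_on N (w j) (w j)"
      unfolding sum_mult_cnj[symmetric] by (simp add: inner_on_def mult.commute)
    then show ?thesis using orth[OF that that] by (metis of_bool_eq(2) of_real_eq_1_iff)
  qed
  have lam_nonneg: "0 \<le> lam (Suc j)" if j: "j < N" for j
  proof -
    define v where "v = vec N (w j)"
    have "(\<rho> *\<^sub>v v) $ a = of_real (lam (Suc j)) * w j a" if "a < N" for a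
    proof -
      have "(\<rho> *\<^sub>v v) $ a = (\<Sum>b<N. \<rho> $$ (a, b) * w j b)"
        using that \<rho>(1) by (auto simp: v_def scalar_prod_def lessThan_atLeast0)
      then show ?thesis using eig[OF j that] by simp
    qed
    then have "cscalar_prod (\<rho> *\<^sub>v v) v = (\<Sum>a<N. of_real (lam (Suc j)) * (w j a * cnj (w j a)))"
      by (simp add: scalar_prod_def v_def lessThan_atLeast0 mult.assoc)
    also have "\<dots> = of_real (lam (Suc j))"
      unfolding sum_distrib_left[symmetric] sum_mult_cnj norm_w[OF j] by simp
    finally show ?thesis using \<rho>_pos[of v] by (simp add: v_def)
  qed
  \<comment> \<open>\<open>X i a\<close> is the inner product of the eigenvector \<open>w i\<close>
    with the basis vector \<open>a\<close>, hence the conjugate, and \<open>Y i b\<close> is its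
    inner product with column \<open>b\<close> of \<open>U\<close>. The mutual inner products of the
    two families are then the entries of \<open>U\<close>.\<close>
  define X where "X i a = cnj (w i a)" for i a
  define Y where "Y i b = (\<Sum>a<N. X i a * U $$ (a, b))" for i b
  have XX: "(\<Sum>i<N. cnj (X i a) * X i b) = of_bool (a = b)" if "a < N" "b < N" for a b
    using orthonormal_complete[of N w a b, OF orth that] by (simp add: X_def)
  have XY: "(\<Sum>i<N. cnj (X i a) * Y i b) = U $$ (a, b)" if a: "a < N" for a b
  proof -
    have "(\<Sum>i<N. cnj (X i a) * Y i b) = (\<Sum>c<N. (\<Sum>i<N. cnj (X i a) * X i c) * U $$ (c, b))"
      unfolding Y_def sum_distrib_left sum_distrib_right by (subst sum.swap) (simp add: mult_ac)
    also have "\<dots> = (\<Sum>c<N. of_bool (a = c) * U $$ (c, b))" using a by (simp add: XX)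
    finally show ?thesis using a by (simp add: sum_of_bool_mult)
  qed
  have YY: "(\<Sum>i<N. cnj (Y i b) * Y i b') = of_bool (b = b')" if "b < N" "b' < N" for b b'
  proof -
    have "(\<Sum>i<N. cnj (Y i b) * Y i b') = (\<Sum>a<N. cnj (U $$ (a, b)) * (\<Sum>i<N. cnj (X i a) * Y i b'))"
      unfolding Y_def[of _ b] cnj_sum sum_distrib_left sum_distrib_right
      by (subst sum.swap) (simp add: mult_ac)
    also have "\<dots> = (\<Sum>a<N. cnj (U $$ (a, b)) * U $$ (a, b'))" by (simp add: XY)
    finally show ?thesis using unitary_cols[OF U that] by simp
  qed
  have \<rho>_spec: "\<rho> $$ (a, b) = (\<Sum>i<N. of_real (lam (Suc i)) * (cnj (X i a) * X i b))"
    if ab: "a < N" "b < N" for a b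
  proof -
    have "(\<Sum>i<N. of_real (lam (Suc i)) * (cnj (X i a) * X i b)) = (\<Sum>i<N. (\<Sum>c<N. \<rho> $$ (a, c) * w i c) * X i b)"
      using ab by (intro sum.cong) (simp_all add: eig X_def)
    also have "\<dots> = (\<Sum>c<N. \<rho> $$ (a, c) * (\<Sum>i<N. cnj (X i c) * X i b))"
      unfolding sum_distrib_left sum_distrib_right by (subst sum.swap) (simp add: X_def mult_ac)
    also have "\<dots> = (\<Sum>c<N. \<rho> $$ (a, c) * of_bool (c = b))" using ab by (simp add: XX)
    finally show ?thesis using ab by (simp add: sum_of_bool_mult)
  qed
  have q_spec: "(mat_adjoint U * \<rho> * U) $$ (b, b) = (\<Sum>i<N. of_real (lam (Suc i)) * (cnj (Y i b) * Y i b))"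
    if b: "b < N" for b
  proof -
    have Ua: "mat_adjoint U \<in> carrier_mat N N" using Ud by (intro carrier_matI) auto
    have "(mat_adjoint U * \<rho> * U) $$ (b, b) = (\<Sum>c<N. (mat_adjoint U * \<rho>) $$ (b, c) * U $$ (c, b))"
      by (rule mat_mult_index_sum) (use Ua Ud \<rho> b in auto)
    also have "\<dots> = (\<Sum>c<N. (\<Sum>a<N. cnj (U $$ (a, b)) * \<rho> $$ (a, c)) * U $$ (c, b))"
    proof (intro sum.cong refl arg_cong2[of _ _ _ _ "(*)"])
      fix c assume "c \<in> {..<N}"
      then have "(mat_adjoint U * \<rho>) $$ (b, c) = (\<Sum>a<N. mat_adjoint U $$ (b, a) * \<rho> $$ (a, c))"
        by (intro mat_mult_index_sum) (use Ua \<rho> b in auto)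
      then show "(mat_adjoint U * \<rho>) $$ (b, c) = (\<Sum>a<N. cnj (U $$ (a, b)) * \<rho> $$ (a, c))"
        using Ud b by (simp add: mat_adjoint_index)
    qed
    also have "\<dots> = (\<Sum>c<N. \<Sum>a<N. \<Sum>i<N. of_real (lam (Suc i)) * ((cnj (U $$ (a, b)) * cnj (X i a)) * (X i c * U $$ (c, b))))"
      by (simp add: \<rho>_spec sum_distrib_left sum_distrib_right mult_ac)
    also have "\<dots> = (\<Sum>c<N. \<Sum>i<N. \<Sum>a<N. of_real (lam (Suc i)) * ((cnj (U $$ (a, b)) * cnj (X i a)) * (X i c * U $$ (c, b))))"
      by (intro sum.cong refl sum.swap)
    also have "\<dots> = (\<Sum>i<N. \<Sum>c<N. \<Sum>a<N. of_real (lam (Suc i)) * ((cnj (U $$ (a, b)) * cnj (X i a)) * (X i c * U $$ (c, b))))"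
      by (rule sum.swap)
    also have "\<dots> = (\<Sum>i<N. \<Sum>a<N. \<Sum>c<N. of_real (lam (Suc i)) * ((cnj (U $$ (a, b)) * cnj (X i a)) * (X i c * U $$ (c, b))))"
      by (intro sum.cong refl sum.swap)
    also have "\<dots> = (\<Sum>i<N. of_real (lam (Suc i)) * (cnj (Y i b) * Y i b))"
      by (simp add: Y_def sum_distrib_left sum_distrib_right mult_ac)
    finally show ?thesis .
  qed
  have cmod_sq: "cnj z * z = of_real ((cmod z)\<^sup>2)" for z
    by (simp only: complex_norm_square mult.commute)
  have p_eq: "p a = (\<Sum>i<N. lam (Suc i) * (cmod (X i a))\<^sup>2)" if "a < N" for a
    using assms(6)[OF that] unfolding \<rho>_spec[OF that that] cmod_sq by simp
  have q_eq: "q b = (\<Sum>i<N. lam (Suc i) * (cmod (Y i b))\<^sup>2)" if "b < N" for b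
    using assms(7)[OF that] unfolding q_spec[OF that] cmod_sq by simp
  have sum_p: "(\<Sum>a<N. p a) = 1"
  proof -
    have "(\<Sum>a<N. p a) = Re (\<Sum>a<N. \<rho> $$ (a, a))" by (simp add: assms(6))
    then show ?thesis by (simp add: \<rho>(3))
  qed
  have sum_lam: "(\<Sum>j=1..N. lam j) = 1"
  proof -
    have "(\<Sum>a<N. p a) = (\<Sum>i<N. \<Sum>a<N. lam (Suc i) * (cmod (w i a))\<^sup>2)"
      by (subst sum.swap) (simp add: p_eq X_def)
    also have "\<dots> = (\<Sum>i<N. lam (Suc i))" by (simp add: norm_w flip: sum_distrib_left)
    finally show ?thesis using sum_p by (simp add: sum.atLeast1_atMost_eq)
  qed
  have lam0: "0 \<le> lam j" if "1 \<le> j" "j \<le> N" for j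
    using lam_nonneg[of "j - 1"] that by simp
  have maj: "(\<Sum>a\<in>A. p a) + (\<Sum>b\<in>B. q b) \<le> S_val N U lam (card A + card B)"
    if AB: "A \<subseteq> {..<N}" "B \<subseteq> {..<N}" for A B
  proof -
    have "(\<Sum>a\<in>A. p a) + (\<Sum>b\<in>B. q b) = (\<Sum>a\<in>A. \<Sum>i<N. lam (Suc i) * (cmod (X i a))\<^sup>2)
        + (\<Sum>b\<in>B. \<Sum>i<N. lam (Suc i) * (cmod (Y i b))\<^sup>2)"
      using AB by (intro arg_cong2[of _ _ _ _ "(+)"] sum.cong refl p_eq q_eq) auto
    also have "\<dots> \<le> S_val N U lam (card A + card B)"
      by (rule sum_le_S_val[OF U AB lam_mono lam0 XX YY XY])
    finally show ?thesis .
  qed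
  have nonneg: "0 \<le> p i" "0 \<le> q i" if "i < N" for i
    using that lam_nonneg by (auto simp: p_eq q_eq intro!: sum_nonneg)
  have sum_q: "(\<Sum>b<N. q b) = 1"
  proof -
    have "(\<Sum>i<N. \<Sum>b<N. lam (Suc i) * (cmod (Y i b))\<^sup>2) = (\<Sum>i<N. lam (Suc i))"
    proof (intro sum.cong refl)
      fix i assume i: "i \<in> {..<N}"
      \<comment> \<open>The sum over \<open>b\<close> runs along the rows of \<open>U\<close>, so
        row orthonormality is the relevant one here.\<close>
      have rowU: "(\<Sum>b<N. U $$ (a, b) * cnj (U $$ (a', b))) = of_bool (a = a')" if "a < N" "a' < N" for a a'
        by (rule orthonormal_complete[of N "\<lambda>b a. U $$ (a, b)"]) (use unitary_cols[OF U] that in \<open>auto simp: inner_on_def\<close>)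
      have "(\<Sum>b<N. (cmod (\<Sum>a<N. U $$ (a, b) * X i a))\<^sup>2) = (\<Sum>a<N. (cmod (X i a))\<^sup>2)"
        by (rule sum_cmod_sq_orthonormal_cols[where u = "\<lambda>b a. U $$ (a, b)"])
          (simp_all add: mult.commute rowU eq_commute[of _ "_ :: nat"])
      then show "(\<Sum>b<N. lam (Suc i) * (cmod (Y i b))\<^sup>2) = lam (Suc i)"
        using norm_w i by (simp add: Y_def mult.commute X_def flip: sum_distrib_left)
    qed
    then show ?thesis
      using sum_lam by (subst (asm) sum.swap) (simp add: q_eq sum.atLeast1_atMost_eq)
  qed
  show ?thesis
  proof (rule entropy_bounds_of_majorization)
    show "0 \<le> W_val N U lam k" if "k \<in> {1..2 * N}" for k
      by (rule W_val_nonneg[OF U lam0 that])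
    show "(\<Sum>k=1..2 * N. W_val N U lam k) = 2"
      unfolding sum_W_val S_val_total[OF U] sum_lam by simp
    show "(\<Sum>a\<in>A. p a) + (\<Sum>b\<in>B. q b) \<le> (\<Sum>k=1..card A + card B. W_val N U lam k)"
      if "A \<subseteq> {..<N}" "B \<subseteq> {..<N}" for A B
      unfolding sum_W_val by (rule maj[OF that])
  qed (use nonneg sum_p sum_q in auto)
qed

end
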